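(* Let $p\in(0,\infty]$, $q\in(0,\infty]$ and let $b$ be a slowly varying function. Assume that either $p\in(1,\infty)$, or that $p=1$ and $b$ is equivalent to a non-increasing function on $(0,\infty)$. Then the fundamental function $\varphi_X$ of $X=L^{p,q,b}$ satisfies $$\varphi_X(t)\approx t^{1/p}b(t)\quad\text{for } t\in(0,\infty),\qquad \varphi_X(\infty)=\infty .$$ Consequently $\varphi_X$ is equivalent to a quasi-concave function, and the corresponding Lorentz and Marcinkiewicz endpoint spaces are $$\Lambda_{\varphi_X}=L^{p,1,b},\qquad M_{\varphi_X}=L^{(p,\infty,b)},$$ up to equivalence of the defining functionals. Moreover, if $p>1$, then the same holds also for $X=L^{(p,q,b)}$.
   Context: $(R,\mu)$ is a $\sigma$-finite non-atomic measure space with $\mu(R)=\infty$; $M=M(R,\mu)$ is the set of extended complex-valued $\mu$-measurable functions on $R$. For $f\in M$, $f^*(t)=\inf\{s\ge 0:\mu(\{|f|>s\})\le t\}$ and $f^{**}(t)=\frac1t\int_0^t f^*(s)\,ds$. Two non-negative functions (or functionals) $g,h$ are equivalent, $g\approx h$, if there are constants $0<c\le C<\infty$ with $cg\le h\le Cg$. Convention: $1/\infty=0$. A measurable $b:(0,\infty)\to(0,\infty)$ is slowly varying if for every $\varepsilon>0$ there are a non-decreasing function $b_\varepsilon$ and a non-increasing function $b_{-\varepsilon}$ with $t^\varepsilon b(t)\approx b_\varepsilon(t)$ and $t^{-\varepsilon}b(t)\approx b_{-\varepsilon}(t)$ on $(0,\infty)$. For $f\in M$, $\lVert f\rVert_{p,q,b}=\lVert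 t^{1/p-1/q}b(t)f^*(t)\rVert_q$ and $\lVert f\rVert_{(p,q,b)}=\lVert t^{1/p-1/q}b(t)f^{**}(t)\rVert_q$, where $\lVert\cdot\rVert_q$ is the Lebesgue $L^q$ (quasi)norm over $(0,\infty)$ in the variable $t$; $L^{p,q,b}$ and $L^{(p,q,b)}$ are the sets of $f\in M$ for which the respective functional is finite. The fundamental function of such a space $X$ with functional $\lVert\cdot\rVert_X$ is $\varphi_X(t)=\lVert\chi_E\rVert_X$, where $E\subseteq R$ is any measurable set with $\mu(E)=t$, $t\in[0,\infty]$ (so $\varphi_X(0)=0$). A function $\varphi:[0,\infty)\to[0,\infty)$ is quasi-concave if it is non-decreasing, vanishes only at $0$, and $t\mapsto t/\varphi(t)$ is non-decreasing on $(0,\infty)$. Every quasi-concave function is equivalent to a non-decreasing concave function vanishing at $0$. If $\varphi$ is equivalent to a quasi-concave function, pick a non-decreasing concave $\psi\approx\varphi$ on $[0,\infty)$ with $\psi(0)=0$. The Marcinkiewicz endpoint space $M_\varphi$ is $\{f\in M:\sup_{t>0}\psi(t)f^{**}(t)<\infty\}$ with this supremum as norm; the Lorentz endpoint space $\Lambda_\varphi$ is $\{f\in M:\int_0^\infty f^*\,d\psi<\infty\}$ with this Lebesgue--Stieltjes integral over $[0,\infty)$ (including a possible atom of mass $\psi(0^+)$ at $0$) as norm. Up to equivalence of norms these do not depend on the choice of $\psi$. *)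

theory Defs
  imports "HOL-Analysis.Analysis" "HOL-Probability.Essential_Supremum"
begin

section \<open>Measurable functions with extended complex values\<close>

datatype ecomplex = Fin complex | Infty

fun emod :: "ecomplex \<Rightarrow> ennreal" where
  "emod (Fin z) = ennreal (cmod z)"
| "emod Infty = \<infinity>"

definition ecomplex_borel :: "ecomplex measure" where
  "ecomplex_borel = sigma UNIV (insert {Infty} {Fin ` A | A. A \<in> sets borel})"

abbreviation measurable_funs :: "'a measure \<Rightarrow> ('a \<Rightarrow> ecomplex) set" where
  "measurable_funs R \<equiv> measurable R ecomplex_borel"

definition char_fun :: "'a set \<Rightarrow> 'a \<Rightarrow> ecomplex" where
  "char_fun E x = Fin (indicator E x)"

definition nonatomic :: "'a measure \<Rightarrow> bool" where
  "nonatomic R \<longleftrightarrow>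
     (\<forall>A\<in>sets R. 0 < emeasure R A \<longrightarrow>
        (\<exists>B\<in>sets R. B \<subseteq> A \<and> 0 < emeasure R B \<and> emeasure R B < emeasure R A))"

section \<open>Rearrangement and maximal function\<close>

text \<open>Letting \<open>s\<close> range over all of \<open>[0,\<infinity>]\<close> only adds the point \<open>\<infinity>\<close> to the set, which does not
  affect the infimum.\<close>

definition rearr :: "'a measure \<Rightarrow> ('a \<Rightarrow> ecomplex) \<Rightarrow> real \<Rightarrow> ennreal" where
  "rearr R f t = Inf {s. emeasure R {x \<in> space R. emod (f x) > s} \<le> ennreal t}"

definition max_rearr :: "'a measure \<Rightarrow> ('a \<Rightarrow> ecomplex) \<Rightarrow> real \<Rightarrow> ennreal" where
  "max_rearr R f t = (\<integral>\<^sup>+ s\<in>{0<..<t}. rearr R f s \<partial>lborel) / ennreal t"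

section \<open>Equivalence and slow variation\<close>

definition equiv_on :: "'b set \<Rightarrow> ('b \<Rightarrow> ennreal) \<Rightarrow> ('b \<Rightarrow> ennreal) \<Rightarrow> bool" where
  "equiv_on S g h \<longleftrightarrow>
     (\<exists>c C :: real. 0 < c \<and> c \<le> C \<and>
        (\<forall>x\<in>S. ennreal c * g x \<le> h x \<and> h x \<le> ennreal C * g x))"

text \<open>Since \<open>ennreal\<close> sends negative reals to \<open>0\<close>, non-negativity of real functions is
  imposed explicitly before they are compared.\<close>

definition slowly_varying :: "(real \<Rightarrow> real) \<Rightarrow> bool" where
  "slowly_varying b \<longleftrightarrow>
     b \<in> borel_measurable (lebesgue_on {0<..}) \<and> (\<forall>t>0. 0 < b t) \<and>
     (\<forall>\<epsilon>>0.
        (\<exists>g :: real \<Rightarrow> real. mono_on {0<..} g \<and> (\<forall>t>0. 0 \<le> g t) \<and>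
           equiv_on {0<..} (\<lambda>t. ennreal (t powr \<epsilon> * b t)) (\<lambda>t. ennreal (g t))) \<and>
        (\<exists>g :: real \<Rightarrow> real. antimono_on {0<..} g \<and> (\<forall>t>0. 0 \<le> g t) \<and>
           equiv_on {0<..} (\<lambda>t. ennreal (t powr (- \<epsilon>) * b t)) (\<lambda>t. ennreal (g t))))"

definition equiv_nonincreasing :: "(real \<Rightarrow> real) \<Rightarrow> bool" where
  "equiv_nonincreasing b \<longleftrightarrow>
     (\<exists>g :: real \<Rightarrow> real. antimono_on {0<..} g \<and> (\<forall>t>0. 0 \<le> g t) \<and>
        equiv_on {0<..} (\<lambda>t. ennreal (b t)) (\<lambda>t. ennreal (g t)))"

section \<open>Lorentz--Karamata functionals\<close>

definition recip :: "ennreal \<Rightarrow> real" where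
  "recip p = enn2real (1 / p)"

definition epowr :: "ennreal \<Rightarrow> real \<Rightarrow> ennreal" where  \<comment> \<open>only used for exponents \<open>a > 0\<close>\<close>
  "epowr x a = (if x = \<infinity> then \<infinity> else ennreal (enn2real x powr a))"

definition Lq_norm :: "ennreal \<Rightarrow> (real \<Rightarrow> ennreal) \<Rightarrow> ennreal" where
  "Lq_norm q g =
     (if q = \<infinity> then esssup (lebesgue_on {0<..}) g
      else epowr (\<integral>\<^sup>+ t. epowr (g t) (enn2real q) \<partial>lebesgue_on {0<..}) (recip q))"

definition LK_norm ::
  "'a measure \<Rightarrow> ennreal \<Rightarrow> ennreal \<Rightarrow> (real \<Rightarrow> real) \<Rightarrow> ('a \<Rightarrow> ecomplex) \<Rightarrow> ennreal" where
  "LK_norm R p q b f =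
     Lq_norm q (\<lambda>t. ennreal (t powr (recip p - recip q) * b t) * rearr R f t)"

definition LK_max_norm ::
  "'a measure \<Rightarrow> ennreal \<Rightarrow> ennreal \<Rightarrow> (real \<Rightarrow> real) \<Rightarrow> ('a \<Rightarrow> ecomplex) \<Rightarrow> ennreal" where
  "LK_max_norm R p q b f =
     Lq_norm q (\<lambda>t. ennreal (t powr (recip p - recip q) * b t) * max_rearr R f t)"

definition space_of :: "'a measure \<Rightarrow> (('a \<Rightarrow> ecomplex) \<Rightarrow> ennreal) \<Rightarrow> ('a \<Rightarrow> ecomplex) set" where
  "space_of R N = {f \<in> measurable_funs R. N f < \<infinity>}"

text \<open>Two functionals on measurable functions define the same space up to equivalence.\<close>

definition same_space ::
  "'a measure \<Rightarrow> (('a \<Rightarrow> ecomplex) \<Rightarrow> ennreal) \<Rightarrow> (('a \<Rightarrow> ecomplex) \<Rightarrow> ennreal) \<Rightarrow> bool" where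
  "same_space R N N' \<longleftrightarrow> space_of R N = space_of R N' \<and> equiv_on (measurable_funs R) N N'"

section \<open>Fundamental function and endpoint spaces\<close>

text \<open>The definite description encodes that the value does not depend on the set \<open>E\<close>.  On a
  \<open>\<sigma>\<close>-finite non-atomic space of infinite measure, sets of every measure \<open>t \<in> [0,\<infinity>]\<close> exist,
  and the functionals above depend on \<open>f\<close> only through its rearrangement.\<close>

definition fundamental_function ::
  "'a measure \<Rightarrow> (('a \<Rightarrow> ecomplex) \<Rightarrow> ennreal) \<Rightarrow> ennreal \<Rightarrow> ennreal" where
  "fundamental_function R N t =
     (THE v. \<forall>E\<in>sets R. emeasure R E = t \<longrightarrow> N (char_fun E) = v)"

definition quasi_concave :: "(real \<Rightarrow> real) \<Rightarrow> bool" where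
  "quasi_concave \<phi> \<longleftrightarrow>
     (\<forall>t\<ge>0. 0 \<le> \<phi> t) \<and> mono_on {0..} \<phi> \<and> (\<forall>t\<ge>0. \<phi> t = 0 \<longleftrightarrow> t = 0) \<and>
     mono_on {0<..} (\<lambda>t. t / \<phi> t)"

definition equiv_quasi_concave :: "(ennreal \<Rightarrow> ennreal) \<Rightarrow> bool" where
  "equiv_quasi_concave \<phi> \<longleftrightarrow>
     (\<exists>\<theta>. quasi_concave \<theta> \<and> equiv_on {0..} (\<lambda>t. \<phi> (ennreal t)) (\<lambda>t. ennreal (\<theta> t)))"

text \<open>The admissible choices of \<open>\<psi>\<close> in the definition of the endpoint spaces of \<open>\<phi>\<close>.\<close>

definition concave_representative :: "(ennreal \<Rightarrow> ennreal) \<Rightarrow> (real \<Rightarrow> real) \<Rightarrow> bool" where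
  "concave_representative \<phi> \<psi> \<longleftrightarrow>
     mono_on {0..} \<psi> \<and> concave_on {0..} \<psi> \<and> \<psi> 0 = 0 \<and>
     equiv_on {0..} (\<lambda>t. \<phi> (ennreal t)) (\<lambda>t. ennreal (\<psi> t))"

definition Marcinkiewicz_norm ::
  "'a measure \<Rightarrow> (real \<Rightarrow> real) \<Rightarrow> ('a \<Rightarrow> ecomplex) \<Rightarrow> ennreal" where
  "Marcinkiewicz_norm R \<psi> f = (SUP t\<in>{0<..}. ennreal (\<psi> t) * max_rearr R f t)"

text \<open>The Lebesgue--Stieltjes measure \<open>d\<psi>\<close> on \<open>[0,\<infinity>)\<close> comes from the right-continuous version
  of \<open>\<psi>\<close> extended by \<open>0\<close> to the negative half-line, which puts the atom of mass \<open>\<psi>(0+)\<close> at \<open>0\<close>.\<close>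

definition stieltjes :: "(real \<Rightarrow> real) \<Rightarrow> real measure" where
  "stieltjes \<psi> = interval_measure (\<lambda>t. if t < 0 then 0 else Lim (at_right t) \<psi>)"

definition Lorentz_norm ::
  "'a measure \<Rightarrow> (real \<Rightarrow> real) \<Rightarrow> ('a \<Rightarrow> ecomplex) \<Rightarrow> ennreal" where
  "Lorentz_norm R \<psi> f = (\<integral>\<^sup>+ t\<in>{0..}. rearr R f t \<partial>stieltjes \<psi>)"

end

theory Submission
  imports Defs
begin

text \<open>Put \<open>B(t) = t\<^sup>1\<^sup>/\<^sup>p b(t)\<close>.  Slow variation yields \<open>a > 0\<close> and \<open>A \<le> 1\<close>, with \<open>A < 1\<close> when
  \<open>p > 1\<close>, such that \<open>B(t)/t\<^sup>a\<close> is almost increasing and \<open>B(t)/t\<^sup>A\<close> almost decreasing.  For a set of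
  measure \<open>m\<close>, the product of \<open>B\<close> with the rearrangement (or, if \<open>A < 1\<close>, the maximal function) of its
  characteristic function is therefore comparable to \<open>B(m)\<close> near \<open>m\<close> and dominated by \<open>B(m)\<close> times a
  two-sided power of \<open>t/m\<close>, whose norm in \<open>L\<^sup>q(dt/t)\<close> does not depend on \<open>m\<close>.
  The infimum over \<open>s\<close> of the affine functions \<open>t \<mapsto> (1 + t/s) B(s)\<close> is a concave
  function equivalent to \<open>B\<close>.  The superlevel sets of a rearrangement are the
  intervals starting at \<open>0\<close>, so by the layer cake formula it suffices to compare \<open>d\<psi>\<close> with \<open>B(t) dt/t\<close>
  on these; both masses are of order \<open>B(s)\<close>.  The essential supremum in the Marcinkiewicz case is a true
  supremum up to constants because \<open>t f\<^sup>*\<^sup>*(t)\<close> and \<open>\<psi>\<close> are non-decreasing.\<close>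

section \<open>Sets of prescribed measure and the layer cake formula\<close>

text \<open>Nonatomicity splits a set of finite positive measure into two pieces of positive
  measure, one of which carries at most half of the total. Iterating this halving \<open>n\<close>
  times with \<open>a / e < 2 ^ n\<close> brings the measure below \<open>e\<close>.\<close>

lemma nonatomic_small_subset:
  assumes na: "nonatomic M" and A: "A \<in> sets M" "0 < emeasure M A" "emeasure M A < \<infinity>" and e: "0 < e"
  shows "\<exists>B\<in>sets M. B \<subseteq> A \<and> 0 < emeasure M B \<and> emeasure M B < ennreal e"
proof -
  have half: "\<exists>B\<in>sets M. B \<subseteq> D \<and> 0 < emeasure M B \<and> 2 * emeasure M B \<le> emeasure M D"
    if D: "D \<in> sets M" "0 < emeasure M D" "emeasure M D < \<infinity>" for D
  proof -
    obtain B where B: "B \<in> sets M" "B \<subseteq> D" "0 < emeasure M B" "emeasure M B < emeasure M D"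
      using na D by (auto simp: nonatomic_def)
    have eq: "emeasure M B + emeasure M (D - B) = emeasure M D"
      using B D by (subst plus_emeasure) (auto simp: Un_absorb1)
    show ?thesis
    proof (cases "emeasure M B \<le> emeasure M (D - B)")
      case True
      then have "2 * emeasure M B \<le> emeasure M D"
        unfolding eq[symmetric] mult_2 by (intro add_left_mono)
      with B show ?thesis by auto
    next
      case False
      then have "2 * emeasure M (D - B) \<le> emeasure M D"
        unfolding eq[symmetric] mult_2 by (intro add_right_mono) auto
      moreover have "0 < emeasure M (D - B)"
        using B eq by (metis add.right_neutral less_irrefl not_gr_zero)
      ultimately show ?thesis using B D by (intro bexI[of _ "D - B"]) auto
    qed
  qed
  have "\<exists>B\<in>sets M. B \<subseteq> A \<and> 0 < emeasure M B \<and> 2 ^ n * emeasure M B \<le> emeasure M A" for n :: nat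
  proof (induction n)
    case 0
    then show ?case using A by auto
  next
    case (Suc n)
    then obtain B where B: "B \<in> sets M" "B \<subseteq> A" "0 < emeasure M B" "2 ^ n * emeasure M B \<le> emeasure M A"
      by auto
    have "emeasure M B < \<infinity>"
      using B A emeasure_mono[of B A M] by auto
    from half[OF B(1,3) this] obtain C where
      C: "C \<in> sets M" "C \<subseteq> B" "0 < emeasure M C" "2 * emeasure M C \<le> emeasure M B" by auto
    have "2 ^ Suc n * emeasure M C = 2 ^ n * (2 * emeasure M C)" by (simp add: mult_ac)
    also have "\<dots> \<le> emeasure M A"
      using C(4) B(4) by (meson mult_left_mono order_trans zero_le)
    finally show ?case using B C by (intro bexI[of _ C]) auto
  qed
  note pow = this
  obtain a where a: "emeasure M A = ennreal a" "0 \<le> a"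
    using A by (cases "emeasure M A") auto
  obtain n :: nat where n: "a / e < 2 ^ n"
    using real_arch_pow[of 2 "a / e"] by auto
  obtain B where B: "B \<in> sets M" "B \<subseteq> A" "0 < emeasure M B" "2 ^ n * emeasure M B \<le> emeasure M A"
    using pow[of n] by auto
  have "emeasure M B < ennreal e"
  proof (rule ccontr)
    assume "\<not> ?thesis"
    then have "2 ^ n * ennreal e \<le> emeasure M A"
      using B(4) by (meson mult_left_mono not_less order_trans zero_le)
    moreover have "2 ^ n * ennreal e = ennreal (2 ^ n * e)"
      using e by (simp add: ennreal_mult' ennreal_power[symmetric])
    ultimately show False using a n e by (simp add: field_simps)
  qed
  with B show ?thesis by auto
qed

text \<open>Greedy exhaustion: at each stage adjoin a set whose measure is at least half of the largest
  possible one that keeps the total below \<open>t\<close>.\<close>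

lemma nonatomic_set_of_measure:
  assumes sf: "sigma_finite_measure M" and na: "nonatomic M"
    and inf: "emeasure M (space M) = \<infinity>"
  shows "\<exists>E\<in>sets M. emeasure M E = t"
proof (cases "t = \<infinity>")
  case True
  then show ?thesis using inf by auto
next
  case False
  interpret sigma_finite_measure M by fact
  define P where "P E B \<longleftrightarrow> B \<in> sets M \<and> B \<inter> E = {} \<and> emeasure M E + emeasure M B \<le> t" for E B
  define S where "S E = (SUP B\<in>Collect (P E). emeasure M B)" for E
  have greedy: "\<exists>B. P E B \<and> S E \<le> 2 * emeasure M B" if E: "emeasure M E \<le> t" for E
  proof (cases "S E = 0")
    case True
    then show ?thesis using E by (intro exI[of _ "{}"]) (auto simp: P_def)
  next
    case nz: False
    \<comment> \<open>The supremum is finite because every competitor is bounded by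
      \<open>t\<close>; being also positive, it exceeds its own half, so some admissible set beats
      that half.\<close>
    have "S E \<le> t"
      unfolding S_def by (rule SUP_least) (auto simp: P_def intro: order_trans[rotated])
    then have fin: "S E < \<infinity>" using \<open>t \<noteq> \<infinity>\<close> by (simp add: less_top top_unique)
    obtain r where r: "S E = ennreal r" "0 < r"
      using nz fin by (cases "S E") (auto simp: less_le)
    have "ennreal (r / 2) < S E" using r by (simp add: ennreal_less_iff)
    then obtain B where "P E B" "ennreal (r / 2) < emeasure M B"
      unfolding S_def less_SUP_iff by auto
    then have "S E \<le> 2 * emeasure M B"
    proof -
      have "S E = 2 * ennreal (r / 2)" using r by (simp add: ennreal_mult'[symmetric] flip: ennreal_numeral)
      then show ?thesis using \<open>ennreal (r / 2) < emeasure M B\<close> by (simp add: mult_left_mono)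
    qed
    with \<open>P E B\<close> show ?thesis by auto
  qed
  have "\<exists>E. \<forall>n :: nat. (E n \<in> sets M \<and> emeasure M (E n) \<le> t) \<and>
      (\<exists>B. P (E n) B \<and> S (E n) \<le> 2 * emeasure M B \<and> E (Suc n) = E n \<union> B)"
  proof (rule dependent_nat_choice)
    show "\<exists>x. x \<in> sets M \<and> emeasure M x \<le> t" by (intro exI[of _ "{}"]) auto
  next
    fix x and n :: nat
    assume x: "x \<in> sets M \<and> emeasure M x \<le> t"
    then obtain B where B: "P x B" "S x \<le> 2 * emeasure M B" using greedy by blast
    have "emeasure M (x \<union> B) \<le> t"
      using x B by (subst plus_emeasure[symmetric]) (auto simp: P_def)
    with B x show "\<exists>y. (y \<in> sets M \<and> emeasure M y \<le> t) \<and> (\<exists>B. P x B \<and> S x \<le> 2 * emeasure M B \<and> y = x \<union> B)"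
      by (intro exI[of _ "x \<union> B"] conjI exI[of _ B]) (auto simp: P_def)
  qed
  then obtain E where E: "\<And>n. E n \<in> sets M" "\<And>n. emeasure M (E n) \<le> t"
    and step: "\<And>n. \<exists>B. P (E n) B \<and> S (E n) \<le> 2 * emeasure M B \<and> E (Suc n) = E n \<union> B"
    by blast
  define F where "F = (\<Union>n. E n)"
  have "incseq E"
    by (rule incseq_SucI) (use step in blast)
  then have lim: "(SUP n. emeasure M (E n)) = emeasure M F"
    unfolding F_def using E by (intro SUP_emeasure_incseq) auto
  have [measurable]: "F \<in> sets M" unfolding F_def by (rule sets.countable_UN) (use E(1) in blast)
  have Ft: "emeasure M F \<le> t"
    unfolding lim[symmetric] by (rule SUP_least) (rule E)
  moreover have "\<not> emeasure M F < t"
  proof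
    assume lt: "emeasure M F < t"
    then obtain d where d: "emeasure M F + ennreal d \<le> t" "0 < d"
    proof -
      obtain x y where "emeasure M F = ennreal x" "0 \<le> x" "t = ennreal y" "0 \<le> y"
        using \<open>t \<noteq> \<infinity>\<close> lt by (cases "emeasure M F"; cases t) auto
      with lt show ?thesis
        by (intro that[of "y - x"]) (auto simp: ennreal_less_iff simp flip: ennreal_plus)
    qed
    \<comment> \<open>Since \<open>F\<close> has finite measure, its complement has infinite
      measure. Sigma-finiteness yields a part of the complement of finite positive measure, from
      which a piece \<open>B\<close> smaller than the gap \<open>d\<close> is cut.\<close>
    have "emeasure M (space M - F) = \<infinity>"
    proof (rule ccontr)
      assume "\<not> ?thesis"
      moreover have "emeasure M (space M - F) + emeasure M F = emeasure M (space M)"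
        using sets.sets_into_space[OF \<open>F \<in> sets M\<close>] by (subst plus_emeasure) (auto simp: Un_absorb2)
      ultimately show False
        using inf Ft \<open>t \<noteq> \<infinity>\<close> by (auto simp: ennreal_add_eq_top top_unique)
    qed
    then obtain Z where Z: "Z \<in> sets M" "Z \<subseteq> space M - F" "emeasure M Z < \<infinity>" "emeasure M Z > ennreal 0"
      using approx_PInf_emeasure_with_finite[of "space M - F" 0] by auto
    from nonatomic_small_subset[OF na Z(1) _ Z(3) \<open>0 < d\<close>] Z(4)
    obtain B where B: "B \<in> sets M" "B \<subseteq> Z" "0 < emeasure M B" "emeasure M B < ennreal d" by auto
    \<comment> \<open>The fixed set \<open>B\<close> is disjoint from every \<open>E n\<close> and
      fits below \<open>t\<close> at every stage, so each greedy choice gains at least half of its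
      measure. Infinitely many such gains overshoot the finite value \<open>t\<close>.\<close>
    have inc: "emeasure M (E n) + emeasure M B / 2 \<le> emeasure M (E (Suc n))" for n
    proof -
      obtain C where C: "P (E n) C" "S (E n) \<le> 2 * emeasure M C" "E (Suc n) = E n \<union> C"
        using step by blast
      have "P (E n) B"
        unfolding P_def
      proof (intro conjI)
        show "B \<inter> E n = {}" using B Z by (auto simp: F_def)
        have "emeasure M (E n) \<le> emeasure M F"
          by (rule emeasure_mono[OF _ \<open>F \<in> sets M\<close>]) (auto simp: F_def)
        then have "emeasure M (E n) + emeasure M B \<le> emeasure M F + ennreal d"
          using B by (intro add_mono) auto
        then show "emeasure M (E n) + emeasure M B \<le> t" using d by order
      qed (rule B)
      then have "emeasure M B \<le> S (E n)" unfolding S_def by (intro SUP_upper) auto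
      then have "emeasure M B \<le> 2 * emeasure M C" using C by order
      then have "emeasure M B / 2 \<le> emeasure M C"
        by (simp add: divide_le_posI_ennreal)
      moreover have "emeasure M (E (Suc n)) = emeasure M (E n) + emeasure M C"
        using C E by (subst plus_emeasure) (auto simp: P_def)
      ultimately show ?thesis by (simp add: add_left_mono)
    qed
    have "of_nat n * (emeasure M B / 2) \<le> emeasure M (E n)" for n
    proof (induction n)
      case (Suc n)
      have "of_nat (Suc n) * (emeasure M B / 2) = of_nat n * (emeasure M B / 2) + emeasure M B / 2"
        by (simp add: distrib_right add.commute)
      also have "\<dots> \<le> emeasure M (E n) + emeasure M B / 2" using Suc by (rule add_right_mono)
      also have "\<dots> \<le> emeasure M (E (Suc n))" by (rule inc)
      finally show ?case .
    qed simp
    then have le: "of_nat n * (emeasure M B / 2) \<le> t" for n using E(2) order_trans by blast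
    obtain x y where xy: "emeasure M B / 2 = ennreal x" "0 < x" "t = ennreal y" "0 \<le> y"
    proof -
      have "emeasure M B / 2 \<noteq> 0" using B by (simp add: ennreal_divide_eq_0_iff)
      moreover have "emeasure M B / 2 \<noteq> \<infinity>"
        using le[of 1] \<open>t \<noteq> \<infinity>\<close> by (auto simp: top_unique)
      ultimately show ?thesis using \<open>t \<noteq> \<infinity>\<close> that
        by (cases "emeasure M B / 2"; cases t) (auto simp: less_le)
    qed
    obtain n :: nat where "y / x < n" using reals_Archimedean2 by blast
    moreover have "real n * x \<le> y"
      using le[of n] xy by (simp add: ennreal_of_nat_eq_real_of_nat ennreal_mult'[symmetric])
    ultimately show False using xy by (simp add: field_simps)
  qed
  ultimately show ?thesis by (intro bexI[of _ F]) auto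
qed

text \<open>Tonelli's theorem for the region under the graph: the value \<open>f x\<close> is the
  length of the set of real levels \<open>l > 0\<close> below it. This remains true for an infinite
  value, where that set is the whole positive half-line.\<close>

lemma nn_integral_layer_cake:
  assumes "sigma_finite_measure M" and [measurable]: "f \<in> borel_measurable M"
  shows "(\<integral>\<^sup>+x. f x \<partial>M) = (\<integral>\<^sup>+l. emeasure M {x \<in> space M. ennreal l < f x} * indicator {0<..} l \<partial>lborel)"
proof -
  interpret sigma_finite_measure M by fact
  interpret pair_sigma_finite M lborel ..
  have "(\<integral>\<^sup>+l. indicator {l. 0 < l \<and> ennreal l < y} l \<partial>lborel) = y" for y :: ennreal
  proof (cases y)
    case (real r)
    then have "{l. 0 < l \<and> ennreal l < y} = {0<..<r}" by (auto simp: ennreal_less_iff)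
    then show ?thesis using real by simp
  next
    case top
    then have *: "{l. 0 < l \<and> ennreal l < y} = {0::real<..}" by (auto simp: ennreal_less_top)
    have "ennreal (real n) \<le> emeasure lborel {0::real<..}" for n :: nat
    proof -
      have "{0<..<real n} \<subseteq> {0<..}" by (rule subsetI) simp
      from emeasure_mono[OF this, of lborel] show ?thesis by simp
    qed
    then have "(SUP n. ennreal (real n)) \<le> emeasure lborel {0::real<..}"
      by (rule SUP_least)
    then show ?thesis unfolding * using top
      by (simp add: ennreal_SUP_of_nat_eq_top top_unique ennreal_of_nat_eq_real_of_nat[symmetric])
  qed
  then have "(\<integral>\<^sup>+x. f x \<partial>M) = (\<integral>\<^sup>+x. \<integral>\<^sup>+l. indicator {(x,l). 0 < l \<and> ennreal l < f x} (x, l) \<partial>lborel \<partial>M)"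
    by (simp add: indicator_def)
  also have "\<dots> = (\<integral>\<^sup>+l. \<integral>\<^sup>+x. indicator {(x,l). 0 < l \<and> ennreal l < f x} (x, l) \<partial>M \<partial>lborel)"
    by (rule Fubini'[symmetric]) measurable
  also have "\<dots> = (\<integral>\<^sup>+l. emeasure M {x \<in> space M. ennreal l < f x} * indicator {0<..} l \<partial>lborel)"
  proof (rule nn_integral_cong)
    fix l :: real
    have "(\<integral>\<^sup>+x. indicator {(x,l). 0 < l \<and> ennreal l < f x} (x, l) \<partial>M)
      = (\<integral>\<^sup>+x. indicator {x \<in> space M. ennreal l < f x} x * indicator {0<..} l \<partial>M)"
      by (rule nn_integral_cong) (auto simp: indicator_def)
    then show "(\<integral>\<^sup>+x. indicator {(x,l). 0 < l \<and> ennreal l < f x} (x, l) \<partial>M)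
      = emeasure M {x \<in> space M. ennreal l < f x} * indicator {0<..} l"
      by (simp add: nn_integral_multc)
  qed
  finally show ?thesis .
qed

section \<open>Rearrangements\<close>

lemma measurable_emod [measurable]: "emod \<in> borel_measurable ecomplex_borel"
proof (rule borel_measurableI_greater)
  fix y :: ennreal
  have gen: "X \<in> sets ecomplex_borel" if "X \<in> insert {Infty} {Fin ` A | A. A \<in> sets borel}" for X
    using that unfolding ecomplex_borel_def by simp
  have "{z. y < ennreal (cmod z)} \<in> sets borel" by measurable
  then have "Fin ` {z. y < ennreal (cmod z)} \<in> sets ecomplex_borel" by (intro gen) blast
  moreover have "{Infty} \<in> sets ecomplex_borel" by (intro gen) auto
  moreover have "{x \<in> space ecomplex_borel. y < emod x} =
      Fin ` {z. y < ennreal (cmod z)} \<union> (if y < \<infinity> then {Infty} else {})"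
  proof (rule set_eqI)
    fix x show "(x \<in> {x \<in> space ecomplex_borel. y < emod x}) =
      (x \<in> Fin ` {z. y < ennreal (cmod z)} \<union> (if y < \<infinity> then {Infty} else {}))"
      by (cases x) (auto simp: ecomplex_borel_def)
  qed
  ultimately show "{x \<in> space ecomplex_borel. y < emod x} \<in> sets ecomplex_borel"
    by (simp only: sets.Un sets.empty_sets split: if_split) auto
qed

text \<open>The Galois connection between the rearrangement and the distribution function. One
  direction is the definition of the infimum; the other is right continuity of the distribution
  function: if the level set at \<open>l\<close> is too large, then so is the one at a slightly
  higher level. The strict form makes every superlevel set of \<open>rearr R f\<close> an initial
  interval.\<close>

lemma less_rearr_iff:
  assumes f[measurable]: "f \<in> measurable_funs R"
  shows "l < rearr R f t \<longleftrightarrow> ennreal t < emeasure R {x \<in> space R. l < emod (f x)}"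
proof
  assume "l < rearr R f t"
  then show "ennreal t < emeasure R {x \<in> space R. l < emod (f x)}"
    unfolding rearr_def using Inf_lower[of l] by (force simp: not_le[symmetric])
next
  assume lt: "ennreal t < emeasure R {x \<in> space R. l < emod (f x)}"
  define D where "D n = {x \<in> space R. l + ennreal (1 / Suc n) < emod (f x)}" for n
  have [measurable]: "D n \<in> sets R" for n unfolding D_def by measurable
  have "l \<noteq> \<infinity>" using lt by auto
  have tends: "(\<lambda>n. l + ennreal (1 / Suc n)) \<longlonglongrightarrow> l + ennreal 0"
    by (intro tendsto_add tendsto_const tendsto_ennrealI LIMSEQ_Suc lim_1_over_n)
  have "{x \<in> space R. l < emod (f x)} = (\<Union>n. D n)"
  proof (intro set_eqI iffI)
    fix x assume x: "x \<in> {x \<in> space R. l < emod (f x)}"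
    then have "eventually (\<lambda>n. l + ennreal (1 / Suc n) < emod (f x)) sequentially"
      using order_tendstoD(2)[OF tends, of "emod (f x)"] by auto
    then obtain n where "l + ennreal (1 / Suc n) < emod (f x)" by (auto simp: eventually_sequentially)
    then show "x \<in> (\<Union>n. D n)" using x by (auto simp: D_def)
  next
    fix x assume "x \<in> (\<Union>n. D n)"
    then show "x \<in> {x \<in> space R. l < emod (f x)}"
      by (auto simp: D_def intro: le_less_trans[rotated])
  qed
  moreover have "incseq D"
  proof (rule incseq_SucI)
    fix n
    have "ennreal (1 / Suc (Suc n)) \<le> ennreal (1 / Suc n)"
      by (intro ennreal_leI) (simp add: field_simps)
    then have "l + ennreal (1 / Suc (Suc n)) \<le> l + ennreal (1 / Suc n)" by (intro add_left_mono)
    then show "D n \<le> D (Suc n)" unfolding D_def by (blast intro: le_less_trans)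
  qed
  ultimately have "(SUP n. emeasure R (D n)) = emeasure R {x \<in> space R. l < emod (f x)}"
    by (subst SUP_emeasure_incseq) auto
  with lt have "ennreal t < (SUP n. emeasure R (D n))" by simp
  then obtain n where n: "ennreal t < emeasure R (D n)" by (simp only: less_SUP_iff) blast
  have "l + ennreal (1 / Suc n) \<le> rearr R f t"
    unfolding rearr_def
  proof (rule Inf_greatest; clarify)
    fix s assume s: "emeasure R {x \<in> space R. s < emod (f x)} \<le> ennreal t"
    show "l + ennreal (1 / Suc n) \<le> s"
    proof (rule ccontr)
      assume "\<not> ?thesis"
      then have "D n \<subseteq> {x \<in> space R. s < emod (f x)}" by (auto simp: D_def not_le intro: less_trans)
      then have "emeasure R (D n) \<le> emeasure R {x \<in> space R. s < emod (f x)}"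
        by (intro emeasure_mono) measurable
      with n s show False by (meson leD order_trans)
    qed
  qed
  moreover have "l < l + ennreal (1 / Suc n)"
    using \<open>l \<noteq> \<infinity>\<close> by (cases l) (auto simp: ennreal_less_iff simp flip: ennreal_plus)
  ultimately show "l < rearr R f t" by order
qed

lemma borel_measurable_rearr [measurable]:
  assumes f: "f \<in> measurable_funs R"
  shows "rearr R f \<in> borel_measurable borel"
  by (rule borel_measurableI_greater) (simp add: less_rearr_iff[OF f])

lemma rearr_char_fun:
  assumes "E \<in> sets R"
  shows "rearr R (char_fun E) t = (if ennreal t < emeasure R E then 1 else 0)"
proof -
  have *: "{x \<in> space R. l < emod (char_fun E x)} = (if l < 1 then E else {})" for l
    using sets.sets_into_space[OF assms] by (auto simp: char_fun_def indicator_def)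
  show ?thesis
  proof (cases "ennreal t < emeasure R E")
    case True
    then have "{s. emeasure R {x \<in> space R. emod (char_fun E x) > s} \<le> ennreal t} = {1..}"
      unfolding * by auto
    with True show ?thesis by (simp add: rearr_def)
  next
    case False
    then have "{s. emeasure R {x \<in> space R. emod (char_fun E x) > s} \<le> ennreal t} = UNIV"
      unfolding * by auto
    with False show ?thesis by (simp add: rearr_def bot_ennreal)
  qed
qed

section \<open>Averages of the rearrangement\<close>

text \<open>The integral depends measurably on its upper endpoint, being a section integral on the
  product space. The hypothesis concerns the rearrangement instead of \<open>f\<close>, so that
  characteristic functions are reached through their explicit rearrangement.\<close>

lemma borel_measurable_max_rearr:
  assumes [measurable]: "rearr R f \<in> borel_measurable borel"
  shows "max_rearr R f \<in> borel_measurable borel"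
proof -
  have [measurable]: "Measurable.pred (borel \<Otimes>\<^sub>M lborel) (\<lambda>x::real \<times> real. snd x \<in> {0<..<fst x})"
    by simp
  have "(\<lambda>(t, s). rearr R f s * indicator {0<..<t} s) \<in> borel_measurable (borel \<Otimes>\<^sub>M lborel)"
    unfolding case_prod_beta by measurable
  from lborel.borel_measurable_nn_integral[OF this] show ?thesis
    unfolding max_rearr_def[abs_def] by measurable
qed

text \<open>The integral defining \<open>max_rearr\<close> grows with its endpoint, and replacing
  the divisor \<open>t\<close> by \<open>u\<close> costs at most a factor 2. A value at one point
  thus controls the values on an interval of positive length, which an essential supremum can
  detect.\<close>

lemma max_rearr_doubling:
  assumes t: "0 < t" "t \<le> u" "u \<le> 2 * t"
  shows "max_rearr R f t \<le> 2 * max_rearr R f u"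
proof -
  define I where "I t = (\<integral>\<^sup>+ s\<in>{0<..<t}. rearr R f s \<partial>lborel)" for t
  have "I t \<le> I u" unfolding I_def using t
    by (intro nn_integral_mono) (auto simp: indicator_def)
  have "I t / ennreal t \<le> I u / ennreal t" by (intro divide_right_mono_ennreal) fact
  also have "\<dots> = 2 * (I u / ennreal (2 * t))"
  proof -
    have "inverse (ennreal t) = 2 * inverse (ennreal (2 * t))"
      using t by (simp add: inverse_ennreal ennreal_mult'[symmetric] flip: ennreal_numeral)
    then show ?thesis by (simp add: divide_ennreal_def mult_ac)
  qed
  also have "\<dots> \<le> 2 * (I u / ennreal u)"
    using t by (auto simp: divide_ennreal_def inverse_ennreal intro!: mult_left_mono ennreal_leI)
      (simp add: field_simps)
  finally show ?thesis by (simp add: max_rearr_def I_def)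
qed

lemma max_rearr_char_fun_eq:
  assumes "E \<in> sets R" "0 < t" "ennreal t < emeasure R E"
  shows "max_rearr R (char_fun E) t = 1"
proof -
  have "(\<integral>\<^sup>+ s\<in>{0<..<t}. rearr R (char_fun E) s \<partial>lborel) = (\<integral>\<^sup>+ s. indicator {0<..<t} s \<partial>lborel)"
  proof (intro nn_integral_cong)
    fix s :: real
    have "ennreal s < emeasure R E" if "s < t"
      using that assms(3) by (meson ennreal_leI le_less_trans less_imp_le)
    then show "rearr R (char_fun E) s * indicator {0<..<t} s = indicator {0<..<t} s"
      using assms(1) by (auto simp: rearr_char_fun indicator_def)
  qed
  also have "\<dots> = ennreal t" using assms by simp
  finally show ?thesis using assms by (simp add: max_rearr_def ennreal_divide_self)
qed

lemma max_rearr_char_fun_le: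
  assumes "E \<in> sets R" "0 < t" "emeasure R E = ennreal m" "0 \<le> m"
  shows "max_rearr R (char_fun E) t \<le> ennreal (m / t)"
proof -
  have "(\<integral>\<^sup>+ s\<in>{0<..<t}. rearr R (char_fun E) s \<partial>lborel) \<le> (\<integral>\<^sup>+ s. indicator {0<..<m} s \<partial>lborel)"
    using assms by (intro nn_integral_mono)
      (auto simp: rearr_char_fun indicator_def ennreal_less_iff)
  also have "\<dots> = ennreal m" using assms by simp
  finally have "max_rearr R (char_fun E) t \<le> ennreal m / ennreal t"
    unfolding max_rearr_def by (rule divide_right_mono_ennreal)
  then show ?thesis using assms by (simp add: divide_ennreal)
qed

lemma max_rearr_cong: "rearr R f = rearr R g \<Longrightarrow> max_rearr R f = max_rearr R g"
  by (simp add: max_rearr_def fun_eq_iff)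

section \<open>Scale-invariant bounds for weighted norms\<close>

lemma epowr_ennreal: "0 \<le> x \<Longrightarrow> epowr (ennreal x) a = ennreal (x powr a)"
  by (simp add: epowr_def)

lemma epowr_mono: "0 \<le> a \<Longrightarrow> x \<le> y \<Longrightarrow> epowr x a \<le> epowr y a"
  by (cases x; cases y) (auto simp: epowr_def top_unique intro!: ennreal_leI powr_mono2)

lemma recip_pos: "0 < q \<Longrightarrow> q < \<infinity> \<Longrightarrow> recip q = 1 / enn2real q \<and> 0 < enn2real q"
  by (cases q) (auto simp: recip_def divide_ennreal simp flip: ennreal_1)

lemma recip_top [simp]: "recip top = 0"
  by (simp add: recip_def)

lemma recip_one [simp]: "recip 1 = 1"
  by (simp add: recip_def)

lemma borel_measurable_lebesgue_on:
  "f \<in> borel_measurable borel \<Longrightarrow> f \<in> borel_measurable (lebesgue_on S)"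
  by (intro measurable_restrict_space1 measurable_completion) simp

lemma nn_integral_lebesgue_on:
  "S \<in> sets lebesgue \<Longrightarrow> (\<integral>\<^sup>+t. f t \<partial>lebesgue_on S) = (\<integral>\<^sup>+t. f t * indicator S t \<partial>lborel)"
  by (simp add: nn_integral_restrict_space nn_integral_completion)

text \<open>With \<open>c = 1 / q\<close>, raising the weighted function to the power
  \<open>q\<close> turns Lebesgue measure into the dilation invariant measure \<open>dt / t\<close>.
  All constants below are independent of scale for this reason.\<close>

lemma powr_recip_mult_powr:
  fixes t x r c :: real
  assumes "0 < t" "0 \<le> x" "0 < r" "c = 1 / r"
  shows "(t powr (- c) * x) powr r = x powr r / t"
proof -
  have "(t powr (- c) * x) powr r = (t powr (- c)) powr r * x powr r"
    by (rule powr_mult)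
  also have "(t powr (- c)) powr r = t powr (- 1)"
    using assms(3) unfolding assms(4) by (simp add: powr_powr)
  finally show ?thesis using assms(1) by (simp add: powr_minus field_simps)
qed

text \<open>For \<open>x > 0\<close> and \<open>d > 0\<close> this is
  \<open>exp (- d * abs (ln x))\<close>: it peaks at 1 and decays at both ends, so it has finite
  norm over \<open>dt / t\<close> for every exponent.\<close>

definition two_sided_powr :: "real \<Rightarrow> real \<Rightarrow> real" where
  "two_sided_powr d x = min (x powr d) (x powr (- d))"

lemma two_sided_powr_nonneg: "0 \<le> two_sided_powr d x"
  by (simp add: two_sided_powr_def)

lemma two_sided_powr_le_one: "0 < d \<Longrightarrow> 0 < x \<Longrightarrow> two_sided_powr d x \<le> 1"
  by (cases "x \<le> 1") (auto simp: two_sided_powr_def min_le_iff_disj powr_le1 powr_minus ge_one_powr_ge_zero inverse_le_1_iff)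

text \<open>Bounding by the increasing power on \<open>[0,s]\<close> and by the decreasing one on
  \<open>[s,oo)\<close> gives two elementary integrals, each equal to \<open>1 / (d * r)\<close>
  whatever \<open>s\<close> is.\<close>

lemma nn_integral_two_sided_powr:
  assumes "0 < d" "0 < r" "0 < s"
  shows "(\<integral>\<^sup>+t. ennreal (two_sided_powr d (t / s) powr r / t) \<partial>lebesgue_on {0<..}) \<le> ennreal (2 / (d * r))"
proof -
  define e where "e = d * r"
  have e: "0 < e" using assms by (simp add: e_def)
  have le1: "two_sided_powr d (t / s) powr r / t \<le> s powr (-e) * t powr (e - 1)" if "0 < t" for t
  proof -
    have "two_sided_powr d (t / s) powr r \<le> ((t / s) powr d) powr r"
      using assms by (intro powr_mono2) (auto simp: two_sided_powr_def)
    also have "\<dots> = s powr (-e) * t powr e"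
      using that assms by (simp add: powr_powr e_def powr_divide powr_minus field_simps)
    finally show ?thesis using that by (simp add: powr_diff divide_right_mono)
  qed
  have le2: "two_sided_powr d (t / s) powr r / t \<le> s powr e * t powr (- e - 1)" if "0 < t" for t
  proof -
    have "two_sided_powr d (t / s) powr r \<le> ((t / s) powr (-d)) powr r"
      using assms by (intro powr_mono2) (auto simp: two_sided_powr_def)
    also have "\<dots> = s powr e * t powr (- e)"
      using that assms by (simp add: powr_powr e_def powr_divide powr_minus field_simps)
    finally show ?thesis using that by (simp add: powr_diff divide_right_mono)
  qed
  have "(\<integral>\<^sup>+t. ennreal (two_sided_powr d (t / s) powr r / t) \<partial>lebesgue_on {0<..})
    = (\<integral>\<^sup>+t. ennreal (two_sided_powr d (t / s) powr r / t) * indicator {0<..} t \<partial>lborel)"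
    by (rule nn_integral_lebesgue_on) auto
  also have "\<dots> \<le> (\<integral>\<^sup>+t. ennreal (s powr (-e) * t powr (e - 1)) * indicator {0..s} t
      + ennreal (s powr e * t powr (- e - 1)) * indicator {s..} t \<partial>lborel)"
  proof (rule nn_integral_mono)
    fix t :: real
    show "ennreal (two_sided_powr d (t / s) powr r / t) * indicator {0<..} t \<le>
      ennreal (s powr (-e) * t powr (e - 1)) * indicator {0..s} t
      + ennreal (s powr e * t powr (- e - 1)) * indicator {s..} t"
    proof (cases "0 < t")
      case True
      then show ?thesis
      proof (cases "t \<le> s")
        case True
        then show ?thesis using \<open>0 < t\<close> ennreal_leI[OF le1[OF \<open>0 < t\<close>]]
          by (auto simp: indicator_def intro: add_increasing2)
      next
        case False
        then show ?thesis using \<open>0 < t\<close> le2[OF \<open>0 < t\<close>]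
          by (auto simp: indicator_def intro!: ennreal_leI)
      qed
    qed auto
  qed
  also have "\<dots> = (\<integral>\<^sup>+t. ennreal (s powr (-e) * t powr (e - 1)) * indicator {0..s} t \<partial>lborel)
      + (\<integral>\<^sup>+t. ennreal (s powr e * t powr (- e - 1)) * indicator {s..} t \<partial>lborel)"
    by (rule nn_integral_add) auto
  also have "(\<integral>\<^sup>+t. ennreal (s powr (-e) * t powr (e - 1)) * indicator {0..s} t \<partial>lborel) = ennreal (1 / e)"
  proof -
    have "((\<lambda>t. s powr (-e) * t powr (e - 1)) has_integral s powr (-e) * (s powr (e - 1 + 1) / (e - 1 + 1))) {0..s}"
      using e assms by (intro has_integral_mult_right has_integral_powr_from_0) auto
    moreover have "s powr (-e) * (s powr (e - 1 + 1) / (e - 1 + 1)) = 1 / e"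
      using assms by (simp add: powr_minus field_simps)
    ultimately show ?thesis by (intro nn_integral_has_integral_lebesgue') auto
  qed
  also have "(\<integral>\<^sup>+t. ennreal (s powr e * t powr (- e - 1)) * indicator {s..} t \<partial>lborel) = ennreal (1 / e)"
  proof -
    have "((\<lambda>t. s powr e * t powr (- e - 1)) has_integral
        s powr e * (- (s powr (- e - 1 + 1)) / (- e - 1 + 1))) {s..}"
      using e assms by (intro has_integral_mult_right has_integral_powr_to_inf) auto
    moreover have "s powr e * (- (s powr (- e - 1 + 1)) / (- e - 1 + 1)) = 1 / e"
      using assms by (simp add: powr_minus field_simps)
    ultimately show ?thesis by (intro nn_integral_has_integral_lebesgue') auto
  qed
  finally show ?thesis using e by (simp add: e_def flip: ennreal_plus)
qed

text \<open>The constant is chosen before \<open>s\<close>, \<open>D\<close> and \<open>G\<close>,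
  which expresses uniformity in the scale. For infinite \<open>q\<close> it is 1, since a two-sided
  power is at most 1 on the positive half-line; for finite \<open>q\<close> it is the root of the
  integral bound for two-sided powers.\<close>

lemma Lq_norm_upper:
  assumes "0 < q" "0 < d"
  obtains K where "0 < K" "\<And>s D G. 0 < s \<Longrightarrow> 0 \<le> D \<Longrightarrow> G \<in> borel_measurable (lebesgue_on {0<..}) \<Longrightarrow>
      (\<And>t. 0 < t \<Longrightarrow> G t \<le> ennreal (D * two_sided_powr d (t / s))) \<Longrightarrow>
      Lq_norm q (\<lambda>t. ennreal (t powr (- recip q)) * G t) \<le> ennreal (K * D)"
proof (cases "q = \<infinity>")
  case True
  show thesis
  proof (rule that[of 1])
    fix s D :: real and G :: "real \<Rightarrow> ennreal"
    assume h: "0 < s" "0 \<le> D" "G \<in> borel_measurable (lebesgue_on {0<..})"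
      "\<And>t. 0 < t \<Longrightarrow> G t \<le> ennreal (D * two_sided_powr d (t / s))"
    note [measurable] = h(3)
    have "G t \<le> ennreal D" if "0 < t" for t
    proof -
      have "D * two_sided_powr d (t / s) \<le> D * 1" using h that assms by (intro mult_left_mono two_sided_powr_le_one) auto
      then show ?thesis using h(4) that by (metis ennreal_leI mult.right_neutral order_trans)
    qed
    then have "ennreal (t powr (- recip q)) * G t \<le> ennreal D" if "0 < t" for t using that True by simp
    moreover have [measurable]: "(\<lambda>t. ennreal (t powr (- recip q))) \<in> borel_measurable (lebesgue_on {0<..})"
      by (intro borel_measurable_lebesgue_on) measurable
    have "(\<lambda>t. ennreal (t powr (- recip q)) * G t) \<in> borel_measurable (lebesgue_on {0<..})"
      by measurable
    ultimately show "Lq_norm q (\<lambda>t. ennreal (t powr (- recip q)) * G t) \<le> ennreal (1 * D)"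
      unfolding Lq_norm_def if_P[OF True] by (intro esssup_I AE_I2) simp_all
  qed auto
next
  case False
  define r where "r = enn2real q"
  have r: "0 < r" "recip q = 1 / r"
    using recip_pos[of q] assms False by (auto simp: r_def less_top)
  define K where "K = (2 / (d * r)) powr (1 / r)"
  have "K > 0" using assms r by (simp add: K_def)
  moreover have "Lq_norm q (\<lambda>t. ennreal (t powr (- recip q)) * G t) \<le> ennreal (K * D)"
    if h: "0 < s" "0 \<le> D" "\<And>t. 0 < t \<Longrightarrow> G t \<le> ennreal (D * two_sided_powr d (t / s))" for s D G
  proof -
    have "(\<integral>\<^sup>+t. epowr (ennreal (t powr (- recip q)) * G t) r \<partial>lebesgue_on {0<..})
      \<le> (\<integral>\<^sup>+t. ennreal (D powr r) * ennreal (two_sided_powr d (t / s) powr r / t) \<partial>lebesgue_on {0<..})"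
    proof (rule nn_integral_mono)
      fix t :: real assume "t \<in> space (lebesgue_on {0<..})"
      then have t: "0 < t" by simp
      have "epowr (ennreal (t powr (- recip q)) * G t) r
        \<le> epowr (ennreal (t powr (- recip q)) * ennreal (D * two_sided_powr d (t / s))) r"
        using h t r by (intro epowr_mono mult_left_mono) auto
      also have "\<dots> = ennreal ((t powr (- recip q) * (D * two_sided_powr d (t / s))) powr r)"
        using h by (subst ennreal_mult'[symmetric]) (auto simp: epowr_ennreal two_sided_powr_nonneg)
      also have "(t powr (- recip q) * (D * two_sided_powr d (t / s))) powr r = D powr r * (two_sided_powr d (t / s) powr r / t)"
        using h t r by (subst powr_recip_mult_powr) (auto simp: two_sided_powr_nonneg powr_mult)
      finally show "epowr (ennreal (t powr (- recip q)) * G t) r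
        \<le> ennreal (D powr r) * ennreal (two_sided_powr d (t / s) powr r / t)"
        by (simp add: ennreal_mult'[symmetric])
    qed
    also have "\<dots> = ennreal (D powr r) * (\<integral>\<^sup>+t. ennreal (two_sided_powr d (t / s) powr r / t) \<partial>lebesgue_on {0<..})"
    proof (rule nn_integral_cmult)
      have "(\<lambda>t. ennreal (two_sided_powr d (t / s) powr r / t)) \<in> borel_measurable borel"
        unfolding two_sided_powr_def by measurable
      then show "(\<lambda>t. ennreal (two_sided_powr d (t / s) powr r / t)) \<in> borel_measurable (lebesgue_on {0<..})"
        by (rule borel_measurable_lebesgue_on)
    qed
    also have "\<dots> \<le> ennreal (D powr r) * ennreal (2 / (d * r))"
      using assms r h by (intro mult_left_mono nn_integral_two_sided_powr) auto
    also have "\<dots> = ennreal (D powr r * (2 / (d * r)))"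
      by (rule ennreal_mult'[symmetric]) simp
    finally have "Lq_norm q (\<lambda>t. ennreal (t powr (- recip q)) * G t)
       \<le> epowr (ennreal (D powr r * (2 / (d * r)))) (1 / r)"
      using False r unfolding Lq_norm_def r_def[symmetric] by (auto intro!: epowr_mono)
    also have "\<dots> = ennreal ((D powr r * (2 / (d * r))) powr (1 / r))"
      using assms r by (intro epowr_ennreal) auto
    also have "(D powr r * (2 / (d * r))) powr (1 / r) = K * D"
      unfolding powr_mult[of "D powr r"] using r h by (simp add: K_def powr_powr)
    finally show ?thesis .
  qed
  ultimately show thesis by (rule that)
qed

text \<open>The interval \<open>(s/2, s)\<close> has mass at least 1/2 for \<open>dt / t\<close>,
  because its length is \<open>s/2\<close> and \<open>1/t\<close> exceeds \<open>1/s\<close> there.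
  This gives the constant \<open>(1/2)^(1/q)\<close>. For infinite \<open>q\<close> it suffices that
  the interval is not a null set.\<close>

lemma Lq_norm_lower:
  assumes "0 < q"
  obtains \<kappa> where "0 < \<kappa>" "\<And>s D G. 0 < s \<Longrightarrow> 0 \<le> D \<Longrightarrow> (\<And>t. t \<in> {s/2<..<s} \<Longrightarrow> ennreal D \<le> G t) \<Longrightarrow>
      ennreal (\<kappa> * D) \<le> Lq_norm q (\<lambda>t. ennreal (t powr (- recip q)) * G t)"
proof (cases "q = \<infinity>")
  case True
  show thesis
  proof (rule that[of 1])
    fix s D :: real and G :: "real \<Rightarrow> ennreal"
    assume h: "0 < s" "0 \<le> D" "\<And>t. t \<in> {s/2<..<s} \<Longrightarrow> ennreal D \<le> G t"
    define g where "g = (\<lambda>t. ennreal (t powr (- recip q)) * G t)"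
    have g: "ennreal D \<le> g t" if "t \<in> {s/2<..<s}" for t
      using h that True by (simp add: g_def)
    show "ennreal (1 * D) \<le> Lq_norm q g"
    proof (rule ccontr)
      assume "\<not> ?thesis"
      then have lt: "esssup (lebesgue_on {0<..}) g < ennreal D"
        by (simp add: Lq_norm_def True)
      have "AE t in lebesgue_on {0<..}. g t \<le> esssup (lebesgue_on {0<..}) g"
        by (rule esssup_AE)
      then have "AE t in lebesgue_on {0<..}. t \<notin> {s/2<..<s}"
        by eventually_elim (use g lt in \<open>fastforce simp: not_le[symmetric]\<close>)
      then have "AE t in lebesgue. t \<in> {0<..} \<longrightarrow> t \<notin> {s/2<..<s}"
        by (subst (asm) AE_restrict_space_iff) auto
      then have "AE t in lebesgue. t \<notin> {s/2<..<s}"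
        by eventually_elim (use h in auto)
      then have "{s/2<..<s} \<in> null_sets lebesgue"
        by (subst AE_iff_null_sets) auto
      then have "emeasure lebesgue {s/2<..<s} = 0" by auto
      then show False using h by simp
    qed
  qed auto
next
  case False
  define r where "r = enn2real q"
  have r: "0 < r" "recip q = 1 / r"
    using recip_pos[of q] assms False by (auto simp: r_def less_top)
  define K :: real where "K = (1 / 2) powr (1 / r)"
  have "K > 0" by (simp add: K_def)
  moreover have "ennreal (K * D) \<le> Lq_norm q (\<lambda>t. ennreal (t powr (- recip q)) * G t)"
    if h: "0 < s" "0 \<le> D" "\<And>t. t \<in> {s/2<..<s} \<Longrightarrow> ennreal D \<le> G t" for s D G
  proof -
    have "ennreal (D powr r / s) * indicator {s/2<..<s} t
      \<le> epowr (ennreal (t powr (- recip q)) * G t) r * indicator {0<..} t" for t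
    proof (cases "t \<in> {s/2<..<s}")
      case True
      then have t: "0 < t" "t < s" using h by auto
      have "D powr r / s \<le> D powr r / t" using t h by (intro divide_left_mono) auto
      also have "\<dots> = (t powr (- recip q) * D) powr r"
        using h t r by (subst powr_recip_mult_powr) auto
      finally have "ennreal (D powr r / s) \<le> ennreal \<dots>" by (rule ennreal_leI)
      also have "\<dots> = epowr (ennreal (t powr (- recip q)) * ennreal D) r"
        using h by (subst ennreal_mult'[symmetric]) (auto simp: epowr_ennreal)
      also have "\<dots> \<le> epowr (ennreal (t powr (- recip q)) * G t) r"
        using h True r by (intro epowr_mono mult_left_mono) auto
      finally show ?thesis using True t by simp
    qed auto
    then have "(\<integral>\<^sup>+t. ennreal (D powr r / s) * indicator {s/2<..<s} t \<partial>lborel)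
      \<le> (\<integral>\<^sup>+t. epowr (ennreal (t powr (- recip q)) * G t) r * indicator {0<..} t \<partial>lborel)"
      by (rule nn_integral_mono)
    also have "(\<integral>\<^sup>+t. ennreal (D powr r / s) * indicator {s/2<..<s} t \<partial>lborel) = ennreal (D powr r / 2)"
      using h by (simp add: nn_integral_cmult_indicator ennreal_mult'[symmetric])
    also have "(\<integral>\<^sup>+t. epowr (ennreal (t powr (- recip q)) * G t) r * indicator {0<..} t \<partial>lborel)
      = (\<integral>\<^sup>+t. epowr (ennreal (t powr (- recip q)) * G t) r \<partial>lebesgue_on {0<..})"
      by (rule nn_integral_lebesgue_on[symmetric]) auto
    finally have "epowr (ennreal (D powr r / 2)) (1 / r) \<le> Lq_norm q (\<lambda>t. ennreal (t powr (- recip q)) * G t)"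
      using False r unfolding Lq_norm_def r_def[symmetric] by (auto intro!: epowr_mono)
    moreover have "epowr (ennreal (D powr r / 2)) (1 / r) = ennreal (K * D)"
      using h r by (simp add: epowr_ennreal K_def powr_divide powr_powr)
    ultimately show ?thesis by simp
  qed
  ultimately show thesis by (rule that)
qed

section \<open>Weights with power bounds\<close>

text \<open>The upper constant may be any real number; enlarging it to \<open>max c C\<close>
  supplies the ordering of the two constants that \<open>equiv_on\<close> demands.\<close>

lemma equiv_onI:
  assumes "0 < c" "\<And>x. x \<in> S \<Longrightarrow> ennreal c * g x \<le> h x" "\<And>x. x \<in> S \<Longrightarrow> h x \<le> ennreal C * g x"
  shows "equiv_on S g h"
  unfolding equiv_on_def
proof (intro exI conjI ballI)
  show "0 < c" "c \<le> max c C" using assms by auto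
  fix x assume x: "x \<in> S"
  show "ennreal c * g x \<le> h x" using assms x by auto
  have "ennreal C * g x \<le> ennreal (max c C) * g x" by (intro mult_right_mono ennreal_leI) auto
  then show "h x \<le> ennreal (max c C) * g x" using assms(3)[OF x] by order
qed

lemma equiv_onE:
  assumes "equiv_on S g h"
  obtains c C :: real where "0 < c" "0 < C" "\<forall>x\<in>S. ennreal c * g x \<le> h x" "\<forall>x\<in>S. h x \<le> ennreal C * g x"
proof -
  from assms obtain c C where *: "0 < c \<and> c \<le> C \<and> (\<forall>x\<in>S. ennreal c * g x \<le> h x \<and> h x \<le> ennreal C * g x)"
    unfolding equiv_on_def by (elim exE)
  then show thesis by (intro that[of c C]) auto
qed

lemma equiv_on_ennrealE:
  assumes "equiv_on S (\<lambda>t. ennreal (u t)) (\<lambda>t. ennreal (v t))"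
    and "\<And>t. t \<in> S \<Longrightarrow> 0 \<le> u t" "\<And>t. t \<in> S \<Longrightarrow> 0 \<le> v t"
  obtains c C where "0 < c" "0 < C" "\<forall>t\<in>S. c * u t \<le> v t" "\<forall>t\<in>S. v t \<le> C * u t"
proof -
  obtain c C :: real where c: "0 < c" "0 < C" "\<forall>t\<in>S. ennreal c * ennreal (u t) \<le> ennreal (v t)"
    "\<forall>t\<in>S. ennreal (v t) \<le> ennreal C * ennreal (u t)"
    using assms(1) by (rule equiv_onE)
  show thesis
  proof (rule that[of c C]; (intro ballI)?)
    fix t assume t: "t \<in> S"
    show "c * u t \<le> v t" "v t \<le> C * u t"
      using c(1,2) bspec[OF c(3) t] bspec[OF c(4) t] assms(2,3)[OF t]
      by (simp_all add: ennreal_mult'[symmetric])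
  qed (use c in auto)
qed

lemma equiv_on_sym:
  assumes "equiv_on S g h"
  shows "equiv_on S h g"
proof -
  obtain c C :: real where c: "0 < c" "0 < C" "\<forall>x\<in>S. ennreal c * g x \<le> h x" "\<forall>x\<in>S. h x \<le> ennreal C * g x"
    using assms by (rule equiv_onE)
  have cancel: "ennreal (1 / k) * (ennreal k * y) = y" if "0 < k" for k y
  proof -
    have "ennreal (1 / k) * ennreal k = 1" using that by (simp add: ennreal_mult'[symmetric])
    then show ?thesis by (simp only: mult.assoc[symmetric] mult_1_left)
  qed
  show ?thesis
  proof (rule equiv_onI[of "1 / C" _ _ _ "1 / c"])
    fix x assume x: "x \<in> S"
    have "ennreal (1 / C) * h x \<le> ennreal (1 / C) * (ennreal C * g x)"
      by (rule mult_left_mono) (use c x in auto)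
    then show "ennreal (1 / C) * h x \<le> g x" using c cancel[of C] by simp
    have "ennreal (1 / c) * (ennreal c * g x) \<le> ennreal (1 / c) * h x"
      by (rule mult_left_mono) (use c x in auto)
    then show "g x \<le> ennreal (1 / c) * h x" using c cancel[of c] by simp
  qed (use c in auto)
qed

lemma equiv_on_trans:
  assumes "equiv_on S f g" "equiv_on S g h"
  shows "equiv_on S f h"
proof -
  obtain c C :: real where c: "0 < c" "0 < C" "\<forall>x\<in>S. ennreal c * f x \<le> g x" "\<forall>x\<in>S. g x \<le> ennreal C * f x"
    using assms(1) by (rule equiv_onE)
  obtain d D :: real where d: "0 < d" "0 < D" "\<forall>x\<in>S. ennreal d * g x \<le> h x" "\<forall>x\<in>S. h x \<le> ennreal D * g x"
    using assms(2) by (rule equiv_onE)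
  show ?thesis
  proof (rule equiv_onI[of "d * c" _ _ _ "D * C"])
    fix x assume x: "x \<in> S"
    have "ennreal d * (ennreal c * f x) \<le> ennreal d * g x" by (rule mult_left_mono) (use c x in auto)
    also have "\<dots> \<le> h x" using d x by blast
    finally show "ennreal (d * c) * f x \<le> h x" using d by (simp add: ennreal_mult' mult.assoc)
    have "h x \<le> ennreal D * g x" using d x by blast
    also have "\<dots> \<le> ennreal D * (ennreal C * f x)" by (rule mult_left_mono) (use c x in auto)
    finally show "h x \<le> ennreal (D * C) * f x" using d by (simp add: ennreal_mult' mult.assoc)
  qed (use c d in auto)
qed

lemma same_spaceI:
  assumes "equiv_on (measurable_funs R) N N'"
  shows "same_space R N N'"
proof -
  have sub: "space_of R h \<subseteq> space_of R g" if eq: "equiv_on (measurable_funs R) g h" for g h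
  proof
    obtain c C :: real where c: "0 < c" "0 < C"
      and le: "\<forall>f\<in>measurable_funs R. ennreal c * g f \<le> h f" "\<forall>f\<in>measurable_funs R. h f \<le> ennreal C * g f"
      using eq by (rule equiv_onE)
    fix f assume f: "f \<in> space_of R h"
    then have "ennreal c * g f < \<infinity>"
      using le(1) by (auto simp: space_of_def intro: le_less_trans)
    then have "g f < \<infinity>" using c by (auto simp: ennreal_mult_less_top)
    then show "f \<in> space_of R g" using f by (simp add: space_of_def)
  qed
  show ?thesis
    using sub[OF assms] sub[OF equiv_on_sym[OF assms]] assms by (auto simp: same_space_def)
qed

lemma two_sided_powr_ge_small:
  assumes "0 < x" "x \<le> 1" "0 < d" "d \<le> a"
  shows "x powr a \<le> two_sided_powr d x"
proof -
  have "x powr a \<le> x powr d" using assms by (intro powr_mono') auto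
  moreover have "x powr d \<le> x powr (- d)" using assms by (intro powr_mono') auto
  ultimately show ?thesis by (simp add: two_sided_powr_def)
qed

lemma two_sided_powr_ge_large:
  assumes "1 \<le> x" "0 < d" "d \<le> a"
  shows "x powr (- a) \<le> two_sided_powr d x"
proof -
  have "x powr (- a) \<le> x powr (- d)" using assms by (intro powr_mono) auto
  moreover have "x powr (- d) \<le> x powr d" using assms by (intro powr_mono) auto
  ultimately show ?thesis by (simp add: two_sided_powr_def)
qed

locale power_weight =
  fixes B :: "real \<Rightarrow> real" and a A C :: real
  assumes meas [measurable]: "B \<in> borel_measurable (lebesgue_on {0<..})"
    and pos: "\<And>t. 0 < t \<Longrightarrow> 0 < B t"
    and exponents: "0 < a" "A \<le> 1"
    and C_pos: "0 < C"
    and lower: "\<And>s t. 0 < s \<Longrightarrow> s \<le> t \<Longrightarrow> B s \<le> C * (s / t) powr a * B t"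
    and upper: "\<And>s t. 0 < s \<Longrightarrow> s \<le> t \<Longrightarrow> B t \<le> C * (t / s) powr A * B s"
begin

lemma nonneg: "0 < t \<Longrightarrow> 0 \<le> B t"
  using pos[of t] by simp

lemma almost_mono: "0 < s \<Longrightarrow> s \<le> t \<Longrightarrow> B s \<le> C * B t"
proof -
  assume s: "0 < s" "s \<le> t"
  have "C * (s / t) powr a * B t \<le> C * 1 * B t"
    using s exponents C_pos nonneg[of t] by (intro mult_mono powr_le1) auto
  with lower[OF s] show ?thesis by simp
qed

lemma le_linear: "0 < s \<Longrightarrow> s \<le> t \<Longrightarrow> B t \<le> C * (t / s) * B s"
proof -
  assume s: "0 < s" "s \<le> t"
  have "(t / s) powr A \<le> (t / s) powr 1"
    using s exponents by (intro powr_mono) auto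
  then have "C * (t / s) powr A * B s \<le> C * (t / s) * B s"
    using s C_pos nonneg[of s] by (intro mult_right_mono mult_left_mono) auto
  with upper[OF s] show ?thesis by simp
qed

text \<open>A single affine function of \<open>t\<close> covers both sides of \<open>s\<close>:
  almost monotonicity handles \<open>t\<close> below \<open>s\<close>, linear growth handles
  \<open>t\<close> above. Consequently each function in the infimum defining \<open>envelope\<close>
  dominates \<open>B\<close> up to the factor \<open>C\<close>.\<close>

lemma le_affine:
  assumes "0 < s" "0 < t"
  shows "B t \<le> C * ((1 + t / s) * B s)"
proof (cases "t \<le> s")
  case True
  have "1 * B s \<le> (1 + t / s) * B s" using assms nonneg by (intro mult_right_mono) auto
  then have "C * (1 * B s) \<le> C * ((1 + t / s) * B s)" using C_pos by (intro mult_left_mono) auto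
  then show ?thesis using almost_mono[of t s] True assms by simp
next
  case False
  have "t / s * B s \<le> (1 + t / s) * B s" using assms nonneg by (intro mult_right_mono) auto
  then have "C * (t / s * B s) \<le> C * ((1 + t / s) * B s)" using C_pos by (intro mult_left_mono) auto
  then show ?thesis using le_linear[of s t] False assms by (simp add: mult.assoc)
qed

lemma unbounded: "\<exists>m>0. y < B m"
proof -
  \<comment> \<open>The bound \<open>lower\<close> from 1 to \<open>m\<close> gives
    \<open>B m\<close> at least \<open>m^a B(1) / C\<close>; the choice of \<open>m\<close> makes
    this at least \<open>abs y + 1\<close>. The maximum with 1 places \<open>m\<close> to the right
    of 1.\<close>
  define m where "m = max 1 (((\<bar>y\<bar> + 1) * C / B 1) powr (1 / a))"
  have m: "0 < m" "1 \<le> m" by (auto simp: m_def)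
  have powr_root: "(x powr (1 / a)) powr a = x" if "0 \<le> x" for x
    using exponents that by (simp add: powr_powr)
  have z: "0 \<le> (\<bar>y\<bar> + 1) * C / B 1" using C_pos pos[of 1] by auto
  have "(\<bar>y\<bar> + 1) * C / B 1 = (((\<bar>y\<bar> + 1) * C / B 1) powr (1 / a)) powr a"
    using powr_root[OF z] by simp
  also have "\<dots> \<le> m powr a"
    using exponents by (intro powr_mono2) (auto simp: m_def)
  finally have "(\<bar>y\<bar> + 1) * C \<le> m powr a * B 1" using pos[of 1] by (simp add: field_simps)
  also have "m powr a * B 1 \<le> m powr a * (C * (1 / m) powr a * B m)"
    using lower[of 1 m] m by (intro mult_left_mono) auto
  also have "\<dots> = B m * C" using m by (simp add: powr_divide)
  finally have "\<bar>y\<bar> + 1 \<le> B m" using C_pos by simp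
  then show ?thesis using m by (intro exI[of _ m]) auto
qed

text \<open>Near 0 the weight lies below a multiple of \<open>t^a\<close> with \<open>a > 0\<close>.
  This limit forces \<open>envelope\<close> to vanish at 0 and concave functions comparable to
  \<open>B\<close> to be continuous there.\<close>

lemma tendsto_0: "(B \<longlongrightarrow> 0) (at_right 0)"
proof (rule tendsto_sandwich)
  show "\<forall>\<^sub>F t in at_right 0. 0 \<le> B t"
    using eventually_at_right_less by (rule eventually_mono) (rule nonneg)
  have "\<forall>\<^sub>F t in at_right 0. (0::real) < t \<and> t < 1"
    by (auto simp: eventually_at_right_field intro!: exI[of _ 1])
  then show "\<forall>\<^sub>F t in at_right 0. B t \<le> C * t powr a * B 1"
    by eventually_elim (use lower[of _ 1] in auto)
  have "((\<lambda>t. t powr a) \<longlongrightarrow> 0 powr a) (at_right (0::real))"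
  proof (intro tendsto_powr' disjI2 conjI tendsto_ident_at tendsto_const)
    show "\<forall>\<^sub>F t in at_right 0. (0::real) \<le> t"
      using eventually_at_right_less by (rule eventually_mono) simp
  qed (rule exponents)
  then have "((\<lambda>t. C * t powr a * B 1) \<longlongrightarrow> C * 0 powr a * B 1) (at_right 0)"
    by (rule tendsto_mult_right[OF tendsto_mult_left])
  then show "((\<lambda>t. C * t powr a * B 1) \<longlongrightarrow> 0) (at_right 0)" using exponents by simp
qed auto

text \<open>Here \<open>F\<close> stands for the rearrangement, or the maximal function, of the
  characteristic function of a set of measure \<open>m\<close>. On \<open>(m/2, m)\<close> the
  linear growth of \<open>B\<close> gives \<open>B t\<close> at least
  \<open>B m / (2 * C)\<close>.\<close>

lemma profile_lower:
  assumes "0 < q"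
  obtains c where "0 < c"
    "\<And>m F. 0 < m \<Longrightarrow> (\<And>t. 0 < t \<Longrightarrow> t < m \<Longrightarrow> F t = 1) \<Longrightarrow>
      ennreal (c * B m) \<le> Lq_norm q (\<lambda>t. ennreal (t powr (- recip q)) * (ennreal (B t) * F t))"
proof (rule Lq_norm_lower[OF assms])
  fix \<kappa> assume \<kappa>: "\<kappa> > 0" "\<And>s D G. 0 < s \<Longrightarrow> 0 \<le> D \<Longrightarrow> (\<And>t. t \<in> {s/2<..<s} \<Longrightarrow> ennreal D \<le> G t) \<Longrightarrow>
      ennreal (\<kappa> * D) \<le> Lq_norm q (\<lambda>t. ennreal (t powr (- recip q)) * G t)"
  show thesis
  proof (rule that[of "\<kappa> / (2 * C)"])
    show "0 < \<kappa> / (2 * C)" using \<kappa> C_pos by simp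
    fix m :: real and F :: "real \<Rightarrow> ennreal"
    assume m: "0 < m" and F: "\<And>t. 0 < t \<Longrightarrow> t < m \<Longrightarrow> F t = 1"
    have "ennreal (B m / (2 * C)) \<le> ennreal (B t) * F t" if t: "t \<in> {m/2<..<m}" for t
    proof -
      have t': "0 < t" "t < m" using t m by auto
      have "B m \<le> C * (m / t) * B t" using t' by (intro le_linear) auto
      also have "\<dots> \<le> C * 2 * B t"
        using t t' C_pos nonneg[of t] by (intro mult_right_mono mult_left_mono) (auto simp: field_simps)
      finally have "B m / (2 * C) \<le> B t" using C_pos by (simp add: field_simps)
      then show ?thesis using F[OF t'] by (simp add: ennreal_leI)
    qed
    then have "ennreal (\<kappa> * (B m / (2 * C))) \<le> Lq_norm q (\<lambda>t. ennreal (t powr (- recip q)) * (ennreal (B t) * F t))"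
      using m nonneg[of m] C_pos by (intro \<kappa>) auto
    then show "ennreal (\<kappa> / (2 * C) * B m) \<le> Lq_norm q (\<lambda>t. ennreal (t powr (- recip q)) * (ennreal (B t) * F t))"
      by simp
  qed
qed

text \<open>A profile equal to 1 everywhere obeys \<open>profile_lower\<close> for all
  \<open>m\<close> at once, and \<open>B\<close> is unbounded.\<close>

lemma profile_infinite:
  assumes "0 < q" "\<And>t. 0 < t \<Longrightarrow> F t = 1"
  shows "Lq_norm q (\<lambda>t. ennreal (t powr (- recip q)) * (ennreal (B t) * F t)) = \<infinity>" (is "?N = _")
proof (rule ccontr)
  assume "?N \<noteq> \<infinity>"
  then obtain y where y: "?N = ennreal y" "0 \<le> y" by (cases ?N) auto
  obtain c where c: "0 < c" "\<And>m. 0 < m \<Longrightarrow> ennreal (c * B m) \<le> ?N"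
  proof (rule profile_lower[OF assms(1)])
    fix c assume "0 < c" "\<And>m F. 0 < m \<Longrightarrow> (\<And>t. 0 < t \<Longrightarrow> t < m \<Longrightarrow> F t = 1) \<Longrightarrow>
      ennreal (c * B m) \<le> Lq_norm q (\<lambda>t. ennreal (t powr (- recip q)) * (ennreal (B t) * F t))"
    then show thesis by (intro that[of c]) (simp_all add: assms(2))
  qed
  obtain m where m: "0 < m" "y / c < B m" using unbounded by blast
  have "c * B m \<le> y" using c(2)[OF m(1)] y c nonneg[OF m(1)] by simp
  with m c show False by (simp add: field_simps)
qed

text \<open>Left of \<open>m\<close> the factor \<open>(t/m)^a\<close> comes from
  \<open>lower\<close>. Right of \<open>m\<close> the profile either vanishes or decays like
  \<open>m/t\<close>; against the growth \<open>(t/m)^A\<close> of \<open>B\<close> this leaves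
  \<open>(t/m)^(-(1-A))\<close>. Both are dominated by a two-sided power of
  \<open>t/m\<close>.\<close>

lemma profile_upper:
  assumes "0 < q"
  obtains c where "0 < c"
    "\<And>m F. 0 < m \<Longrightarrow> F \<in> borel_measurable (lebesgue_on {0<..}) \<Longrightarrow> (\<And>t. F t \<le> 1) \<Longrightarrow>
      (\<And>t. m \<le> t \<Longrightarrow> F t = 0 \<or> A < 1 \<and> F t \<le> ennreal (m / t)) \<Longrightarrow>
      Lq_norm q (\<lambda>t. ennreal (t powr (- recip q)) * (ennreal (B t) * F t)) \<le> ennreal (c * B m)"
proof -
  \<comment> \<open>The weaker of the two decay exponents \<open>a\<close> and \<open>1 - A\<close>.
    When \<open>A = 1\<close> the profile vanishes beyond \<open>m\<close>, and only the behaviour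
    near 0 counts.\<close>
  define d where "d = (if A < 1 then min a (1 - A) else a)"
  have d: "0 < d" "d \<le> a" "A < 1 \<Longrightarrow> d \<le> 1 - A" using exponents by (auto simp: d_def)
  show thesis
  proof (rule Lq_norm_upper[OF assms d(1)])
    fix K assume K: "K > 0" "\<And>s D G. 0 < s \<Longrightarrow> 0 \<le> D \<Longrightarrow> G \<in> borel_measurable (lebesgue_on {0<..}) \<Longrightarrow>
        (\<And>t. 0 < t \<Longrightarrow> G t \<le> ennreal (D * two_sided_powr d (t / s))) \<Longrightarrow>
        Lq_norm q (\<lambda>t. ennreal (t powr (- recip q)) * G t) \<le> ennreal (K * D)"
    show thesis
    proof (rule that[of "K * C"])
      show "0 < K * C" using K C_pos by simp
      fix m :: real and F :: "real \<Rightarrow> ennreal"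
      assume m: "0 < m" and [measurable]: "F \<in> borel_measurable (lebesgue_on {0<..})"
        and F: "\<And>t. F t \<le> 1" "\<And>t. m \<le> t \<Longrightarrow> F t = 0 \<or> A < 1 \<and> F t \<le> ennreal (m / t)"
      have "ennreal (B t) * F t \<le> ennreal (C * B m * two_sided_powr d (t / m))" if t: "0 < t" for t
      proof (cases "t \<le> m")
        case True
        have "ennreal (B t) * F t \<le> ennreal (B t) * 1" by (intro mult_left_mono F) auto
        also have "\<dots> \<le> ennreal (C * B m * (t / m) powr a)"
          using lower[OF t True] by (simp add: ennreal_leI mult_ac)
        also have "\<dots> \<le> ennreal (C * B m * two_sided_powr d (t / m))"
          using t True m d C_pos nonneg[of m]
          by (intro ennreal_leI mult_left_mono two_sided_powr_ge_small) auto
        finally show ?thesis .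
      next
        case False
        then consider "F t = 0" | "A < 1" "F t \<le> ennreal (m / t)" using F(2)[of t] by auto
        then show ?thesis
        proof cases
          case 2
          have "ennreal (B t) * F t \<le> ennreal (B t) * ennreal (m / t)" by (intro mult_left_mono 2) auto
          also have "\<dots> = ennreal (B t * (m / t))" using nonneg[OF t] by (rule ennreal_mult'[symmetric])
          also have "\<dots> \<le> ennreal (C * (t / m) powr A * B m * (m / t))"
            using upper[of m t] m False by (intro ennreal_leI mult_right_mono) auto
          also have "C * (t / m) powr A * B m * (m / t) = C * B m * (t / m) powr (- (1 - A))"
          proof -
            have "(t / m) powr A * (m / t) = (t / m) powr A / (t / m) powr 1" using t m by simp
            also have "\<dots> = (t / m) powr (- (1 - A))" by (subst powr_diff[symmetric]) simp
            finally show ?thesis by (simp add: mult_ac)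
          qed
          also have "ennreal (C * B m * (t / m) powr (- (1 - A))) \<le> ennreal (C * B m * two_sided_powr d (t / m))"
            using t False m d 2 C_pos nonneg[of m]
            by (intro ennreal_leI mult_left_mono two_sided_powr_ge_large) auto
          finally show ?thesis .
        qed simp
      qed
      then show "Lq_norm q (\<lambda>t. ennreal (t powr (- recip q)) * (ennreal (B t) * F t)) \<le> ennreal (K * C * B m)"
        unfolding mult.assoc[of K] using m nonneg[of m] C_pos by (intro K) auto
    qed
  qed
qed

section \<open>A concave function equivalent to the weight\<close>

definition envelope :: "real \<Rightarrow> real" where
  "envelope t = (INF s\<in>{0<..}. (1 + t / s) * B s)"

lemma envelope_bdd: "0 \<le> t \<Longrightarrow> bdd_below ((\<lambda>s. (1 + t / s) * B s) ` {0<..})"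
  by (rule bdd_belowI[of _ 0]) (auto intro!: mult_nonneg_nonneg nonneg)

lemma envelope_le: "0 \<le> t \<Longrightarrow> 0 < s \<Longrightarrow> envelope t \<le> (1 + t / s) * B s"
  unfolding envelope_def by (rule cINF_lower[OF envelope_bdd]) auto

lemma envelope_greatest: "(\<And>s. 0 < s \<Longrightarrow> y \<le> (1 + t / s) * B s) \<Longrightarrow> y \<le> envelope t"
  unfolding envelope_def by (rule cINF_greatest) auto

lemma envelope_nonneg: "0 \<le> t \<Longrightarrow> 0 \<le> envelope t"
  by (intro envelope_greatest mult_nonneg_nonneg nonneg) auto

lemma envelope_upper: "0 < t \<Longrightarrow> envelope t \<le> 2 * B t"
  using envelope_le[of t t] by simp

lemma envelope_lower: "0 < t \<Longrightarrow> B t / C \<le> envelope t"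
  by (rule envelope_greatest) (use le_affine[of _ t] C_pos in \<open>simp add: pos_divide_le_eq mult_ac\<close>)

lemma envelope_0: "envelope 0 = 0"
proof (rule antisym)
  \<comment> \<open>At \<open>t = 0\<close> the family reduces to the values \<open>B s\<close>,
    which tend to 0 with \<open>s\<close>.\<close>
  show "envelope 0 \<le> 0"
  proof (rule tendsto_lowerbound[OF tendsto_0])
    show "\<forall>\<^sub>F t in at_right 0. envelope 0 \<le> B t"
      using eventually_at_right_less by (rule eventually_mono) (use envelope_le[of 0] in auto)
  qed auto
qed (simp add: envelope_nonneg)

lemma mono_envelope: "mono_on {0..} envelope"
proof (rule mono_onI)
  fix x y :: real assume "x \<in> {0..}" "y \<in> {0..}" "x \<le> y"
  then show "envelope x \<le> envelope y"
    by (intro envelope_greatest) (rule order_trans[OF envelope_le[of x]],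
      auto intro!: mult_right_mono nonneg add_left_mono divide_right_mono)
qed

lemma concave_envelope: "concave_on {0..} envelope"
  unfolding concave_on_iff
proof (intro conjI ballI allI impI)
  fix x y u v :: real
  assume h: "x \<in> {0..}" "y \<in> {0..}" "0 \<le> u" "0 \<le> v" "u + v = 1"
  show "u * envelope x + v * envelope y \<le> envelope (u *\<^sub>R x + v *\<^sub>R y)"
  proof (rule envelope_greatest)
    fix s :: real assume s: "0 < s"
    have "u * envelope x + v * envelope y \<le> u * ((1 + x / s) * B s) + v * ((1 + y / s) * B s)"
      using h s by (intro add_mono mult_left_mono envelope_le) auto
    also have "\<dots> = ((u + v) + (u * x + v * y) / s) * B s"
      by (simp add: algebra_simps add_divide_distrib)
    also have "\<dots> = (1 + (u *\<^sub>R x + v *\<^sub>R y) / s) * B s" using h by simp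
    finally show "u * envelope x + v * envelope y \<le> \<dots>" .
  qed
qed (rule convex_real_interval)

lemma envelope_pos: "0 < t \<Longrightarrow> 0 < envelope t"
  using envelope_lower[of t] pos[of t] C_pos by (auto intro: less_le_trans[OF divide_pos_pos])

text \<open>Monotonicity of the quotient amounts to \<open>(x/y) envelope y\<close> being at most
  \<open>envelope x\<close> for \<open>x\<close> below \<open>y\<close>. It holds for each affine
  member, since \<open>(x/y) (1 + y/s) = x/y + x/s\<close> is at most \<open>1 + x/s\<close>, and
  passes to the infimum.\<close>

lemma quasi_concave_envelope: "quasi_concave envelope"
  unfolding quasi_concave_def
proof (intro conjI allI impI)
  show "mono_on {0<..} (\<lambda>t. t / envelope t)"
  proof (rule mono_onI)
    fix x y :: real assume x: "x \<in> {0<..}" "y \<in> {0<..}" "x \<le> y"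
    have "envelope y * x / y \<le> envelope x"
    proof (rule envelope_greatest)
      fix s :: real assume s: "0 < s"
      have "envelope y * x / y \<le> ((1 + y / s) * B s) * x / y"
        using x s by (intro divide_right_mono mult_right_mono envelope_le) auto
      also have "\<dots> = (x / y + x / s) * B s" using x s by (simp add: field_simps)
      also have "\<dots> \<le> (1 + x / s) * B s"
        using x s nonneg by (intro mult_right_mono) auto
      finally show "envelope y * x / y \<le> (1 + x / s) * B s" .
    qed
    then show "x / envelope x \<le> y / envelope y"
      using x envelope_pos[of x] envelope_pos[of y] by (simp add: field_simps)
  qed
  show "(envelope t = 0) = (t = 0)" if "0 \<le> t" for t
    using that envelope_0 envelope_pos[of t] by (cases "t = 0") auto
qed (auto simp: envelope_nonneg mono_envelope)

end

section \<open>The endpoint spaces of a concave weight\<close>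

text \<open>By the layer cake formula only the masses of superlevel sets enter, so integrals against
  two unrelated measures become comparable level by level.\<close>

lemma nn_integral_le_level_sets:
  assumes M: "sigma_finite_measure M" and N: "sigma_finite_measure N"
    and f [measurable]: "f \<in> borel_measurable M" and g [measurable]: "g \<in> borel_measurable N"
    and le: "\<And>l. 0 < l \<Longrightarrow> emeasure M {x \<in> space M. ennreal l < f x} \<le> K * emeasure N {x \<in> space N. ennreal l < g x}"
  shows "(\<integral>\<^sup>+x. f x \<partial>M) \<le> K * (\<integral>\<^sup>+x. g x \<partial>N)"
proof -
  interpret N: sigma_finite_measure N by fact
  have [measurable]: "(\<lambda>l. emeasure N {x \<in> space N. ennreal l < g x}) \<in> borel_measurable lborel"
    by measurable
  have "(\<integral>\<^sup>+x. f x \<partial>M) \<le> (\<integral>\<^sup>+l. K * (emeasure N {x \<in> space N. ennreal l < g x} * indicator {0<..} l) \<partial>lborel)"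
    unfolding nn_integral_layer_cake[OF M f]
    by (rule nn_integral_mono) (auto simp: indicator_def le)
  also have "\<dots> = K * (\<integral>\<^sup>+x. g x \<partial>N)"
    unfolding nn_integral_layer_cake[OF N g] by (rule nn_integral_cmult) measurable
  finally show ?thesis .
qed

lemma sigma_finite_lebesgue: "sigma_finite_measure (lebesgue :: real measure)"
proof
  show "\<exists>A::real set set. countable A \<and> A \<subseteq> sets lebesgue \<and> \<Union>A = space lebesgue \<and> (\<forall>a\<in>A. emeasure lebesgue a \<noteq> \<infinity>)"
  proof (intro exI conjI)
    show "\<Union>(range (\<lambda>n::nat. {- real n..real n})) = space lebesgue"
    proof (intro set_eqI iffI)
      fix x :: real
      obtain n :: nat where "\<bar>x\<bar> \<le> n" using real_arch_simple by blast
      then show "x \<in> \<Union>(range (\<lambda>n::nat. {- real n..real n}))" by (auto intro!: exI[of _ n])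
    qed simp
  qed auto
qed

locale concave_weight = power_weight +
  fixes \<psi> :: "real \<Rightarrow> real" and c D :: real
  assumes mono: "mono_on {0..} \<psi>" and conc: "concave_on {0..} \<psi>" and zero: "\<psi> 0 = 0"
    and c_pos: "0 < c" and ge: "\<And>t. 0 < t \<Longrightarrow> c * B t \<le> \<psi> t"
    and D_pos: "0 < D" and le: "\<And>t. 0 < t \<Longrightarrow> \<psi> t \<le> D * B t"
begin

lemma psi_nonneg: "0 \<le> t \<Longrightarrow> 0 \<le> \<psi> t"
  using mono_onD[OF mono, of 0 t] zero by simp

text \<open>Interior points are covered by concavity; at 0 the function is squeezed below
  \<open>D * B\<close>. Continuity makes the right-continuous version in \<open>stieltjes\<close>
  agree with the function itself and rules out atoms, including one at 0.\<close>

lemma psi_continuous: "continuous_on {0..} \<psi>"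
  unfolding continuous_on_eq_continuous_within
proof
  fix x :: real assume "x \<in> {0..}"
  then consider "x = 0" | "0 < x" by fastforce
  then show "continuous (at x within {0..}) \<psi>"
  proof cases
    case 1
    have pos: "\<forall>\<^sub>F t in at_right 0. (0::real) < t" by (rule eventually_at_right_less)
    have "(\<psi> \<longlongrightarrow> 0) (at_right 0)"
    proof (rule tendsto_sandwich)
      show "\<forall>\<^sub>F t in at_right 0. 0 \<le> \<psi> t" using pos by (rule eventually_mono) (simp add: psi_nonneg)
      show "\<forall>\<^sub>F t in at_right 0. \<psi> t \<le> D * B t" using pos by (rule eventually_mono) (rule le)
      show "((\<lambda>t. D * B t) \<longlongrightarrow> 0) (at_right 0)" using tendsto_mult_left[OF tendsto_0, of D] by simp
    qed simp
    then show ?thesis using 1 zero by (simp add: continuous_within at_within_Ici_at_right)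
  next
    case 2
    have "convex_on {0<..} (\<lambda>x. - \<psi> x)"
      using conc unfolding concave_on_def by (rule convex_on_subset) auto
    then have "continuous_on {0<..} (\<lambda>x. - (- \<psi> x))"
      by (intro continuous_intros convex_on_continuous) auto
    then have "isCont \<psi> x" using 2 by (simp add: continuous_on_eq_continuous_at)
    then show ?thesis by (rule continuous_at_imp_continuous_at_within)
  qed
qed

text \<open>As \<open>\<psi> 0 = 0\<close>, this is a continuous non-decreasing function on the
  whole line; it is the distribution function behind \<open>stieltjes\<close>.\<close>

definition extension :: "real \<Rightarrow> real" where "extension t = \<psi> (max t 0)"

lemma mono_extension: "s \<le> t \<Longrightarrow> extension s \<le> extension t"
  unfolding extension_def by (rule mono_onD[OF mono]) auto

lemma continuous_extension: "continuous_on UNIV extension"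
  unfolding extension_def by (rule continuous_on_compose2[OF psi_continuous]) (auto intro!: continuous_intros)

lemma stieltjes_eq: "stieltjes \<psi> = interval_measure extension"
proof -
  have "(if t < 0 then 0 else Lim (at_right t) \<psi>) = extension t" for t
  proof (cases "t < 0")
    case False
    have "(extension \<longlongrightarrow> extension t) (at_right t)"
      using continuous_extension by (auto simp: continuous_on_def intro: tendsto_within_subset)
    moreover have "\<forall>\<^sub>F s in at_right t. extension s = \<psi> s"
      using eventually_at_right_less by (rule eventually_mono) (use False in \<open>auto simp: extension_def max_def\<close>)
    ultimately have "(\<psi> \<longlongrightarrow> extension t) (at_right t)" by (rule Lim_transform_eventually)
    then have "Lim (at_right t) \<psi> = extension t" by (intro tendsto_Lim) auto
    then show ?thesis using False by simp
  qed (simp add: extension_def zero max_def)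
  then show ?thesis by (simp add: stieltjes_def)
qed

lemma emeasure_stieltjes: "0 \<le> s \<Longrightarrow> emeasure (stieltjes \<psi>) {0..s} = ennreal (\<psi> s)"
  unfolding stieltjes_eq
  by (subst emeasure_interval_measure_Icc[OF _ mono_extension continuous_extension]) (auto simp: extension_def zero max_def)

lemma sigma_finite_stieltjes: "sigma_finite_measure (stieltjes \<psi>)"
  unfolding stieltjes_eq
proof (rule sigma_finite_interval_measure[OF mono_extension])
  show "continuous (at_right a) extension" for a
    using continuous_extension by (simp add: continuous_on_eq_continuous_within continuous_at_imp_continuous_at_within)
qed

lemma sets_stieltjes [simp, measurable_cong]: "sets (stieltjes \<psi>) = sets borel"
  by (simp add: stieltjes_def)

lemma space_stieltjes [simp]: "space (stieltjes \<psi>) = UNIV"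
  by (simp add: stieltjes_def)

text \<open>The measure \<open>B(t) dt/t\<close> on the positive half-line, against which the
  Lorentz functional with \<open>q = 1\<close> is a plain integral of the rearrangement.\<close>

definition weighted_measure :: "real measure" where
  "weighted_measure = density (lebesgue_on {0<..}) (\<lambda>t. ennreal (t powr (- 1)) * ennreal (B t))"

lemma weight_measurable [measurable]:
  "(\<lambda>t. ennreal (t powr (- 1)) * ennreal (B t)) \<in> borel_measurable (lebesgue_on {0<..})"
proof -
  have [measurable]: "(\<lambda>t::real. ennreal (t powr (- 1))) \<in> borel_measurable (lebesgue_on {0<..})"
    by (rule borel_measurable_lebesgue_on) measurable
  show ?thesis by measurable
qed

lemma sigma_finite_weighted: "sigma_finite_measure weighted_measure"
proof -
  interpret L: sigma_finite_measure "lebesgue_on {0::real<..}"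
    by (rule sigma_finite_measure_restrict_space[OF sigma_finite_lebesgue]) auto
  show ?thesis unfolding weighted_measure_def
    by (subst L.sigma_finite_iff_density_finite[OF weight_measurable])
      (auto simp: ennreal_mult_eq_top_iff)
qed

lemma nn_integral_weighted:
  assumes [measurable]: "g \<in> borel_measurable (lebesgue_on {0<..})"
  shows "(\<integral>\<^sup>+t. g t \<partial>weighted_measure) = Lq_norm 1 (\<lambda>t. ennreal (t powr (- recip 1)) * (ennreal (B t) * g t))"
proof -
  have [simp]: "epowr x 1 = x" for x by (cases x) (auto simp: epowr_def)
  show ?thesis unfolding weighted_measure_def Lq_norm_def
    by (simp only: nn_integral_density[OF weight_measurable assms]) (simp add: mult.assoc)
qed

text \<open>The sets are the possible superlevel sets of a rearrangement, with \<open>d\<close> a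
  value of the distribution function and hence possibly infinite. For \<open>d = 0\<close> both are
  empty, for finite \<open>d = s > 0\<close> both masses are of order \<open>B s\<close>, and for
  infinite \<open>d\<close> both masses are infinite.\<close>

lemma level_sets_comparable:
  obtains K L :: real where "0 < K" "0 < L"
    "\<forall>d. emeasure (stieltjes \<psi>) {t. 0 \<le> t \<and> ennreal t < d} \<le> ennreal K * emeasure weighted_measure {t. 0 < t \<and> ennreal t < d}"
    "\<forall>d. emeasure weighted_measure {t. 0 < t \<and> ennreal t < d} \<le> ennreal L * emeasure (stieltjes \<psi>) {t. 0 \<le> t \<and> ennreal t < d}"
proof (rule profile_lower[of 1]; (rule zero_less_one)?)
  fix k1 assume k1: "0 < k1" "\<And>m F. 0 < m \<Longrightarrow> (\<And>t. 0 < t \<Longrightarrow> t < m \<Longrightarrow> F t = 1) \<Longrightarrow>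
      ennreal (k1 * B m) \<le> Lq_norm 1 (\<lambda>t. ennreal (t powr (- recip 1)) * (ennreal (B t) * F t))"
  show thesis
  proof (rule profile_upper[of 1]; (rule zero_less_one)?)
    fix k2 assume k2: "0 < k2" "\<And>m F. 0 < m \<Longrightarrow> F \<in> borel_measurable (lebesgue_on {0<..}) \<Longrightarrow> (\<And>t. F t \<le> 1) \<Longrightarrow>
      (\<And>t. m \<le> t \<Longrightarrow> F t = 0 \<or> A < 1 \<and> F t \<le> ennreal (m / t)) \<Longrightarrow>
      Lq_norm 1 (\<lambda>t. ennreal (t powr (- recip 1)) * (ennreal (B t) * F t)) \<le> ennreal (k2 * B m)"
    define F :: "ennreal \<Rightarrow> real \<Rightarrow> ennreal" where "F d t = indicator {t. ennreal t < d} t" for d t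
    have F [measurable]: "F d \<in> borel_measurable (lebesgue_on {0<..})" for d
      unfolding F_def by (rule borel_measurable_lebesgue_on) measurable
    have sets_W: "{t. 0 < t \<and> ennreal t < d} \<in> sets weighted_measure" for d
    proof -
      have "{t \<in> space (lebesgue_on {0<..}). F d t = 1} \<in> sets (lebesgue_on {0<..})"
        by measurable
      moreover have "{t \<in> space (lebesgue_on {0<..}). F d t = 1} = {t. 0 < t \<and> ennreal t < d}"
        by (auto simp: F_def indicator_def split: if_splits)
      ultimately show ?thesis by (simp add: weighted_measure_def)
    qed
    have W_eq: "emeasure weighted_measure {t. 0 < t \<and> ennreal t < d} =
      Lq_norm 1 (\<lambda>t. ennreal (t powr (- recip 1)) * (ennreal (B t) * F d t))" for d
    proof -
      have "emeasure weighted_measure {t. 0 < t \<and> ennreal t < d} = (\<integral>\<^sup>+t. indicator {t. 0 < t \<and> ennreal t < d} t \<partial>weighted_measure)"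
        by (rule nn_integral_indicator[symmetric]) (rule sets_W)
      also have "\<dots> = (\<integral>\<^sup>+t. F d t \<partial>weighted_measure)"
        by (rule nn_integral_cong) (auto simp: F_def weighted_measure_def indicator_def)
      finally show ?thesis by (simp add: nn_integral_weighted[OF F])
    qed
    define V where "V d = emeasure (stieltjes \<psi>) {t. 0 \<le> t \<and> ennreal t < d}" for d
    have Vset [measurable]: "{t. 0 \<le> t \<and> ennreal t < d} \<in> sets (stieltjes \<psi>)" for d
    proof -
      have "{t. 0 \<le> t \<and> ennreal t < d} \<in> sets borel" by measurable
      then show ?thesis by simp
    qed
    have V_lower: "ennreal (c * B s) \<le> V d" if "0 < s" "ennreal s < d" for s d
    proof -
      have "ennreal (c * B s) \<le> emeasure (stieltjes \<psi>) {0..s}"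
        using that by (simp add: emeasure_stieltjes ge ennreal_leI)
      also have "\<dots> \<le> V d"
        unfolding V_def
      proof (rule emeasure_mono)
        show "{0..s} \<subseteq> {t. 0 \<le> t \<and> ennreal t < d}"
          using that by (auto intro: le_less_trans[OF ennreal_leI])
      qed (rule Vset)
      finally show ?thesis .
    qed
    have V_upper: "V (ennreal s) \<le> ennreal (D * B s)" if "0 < s" for s
    proof -
      have "V (ennreal s) \<le> emeasure (stieltjes \<psi>) {0..s}"
        unfolding V_def by (rule emeasure_mono) (auto simp: ennreal_less_iff)
      also have "\<dots> \<le> ennreal (D * B s)"
        using that by (simp add: emeasure_stieltjes le ennreal_leI)
      finally show ?thesis .
    qed
    have W_lower: "ennreal (k1 * B s) \<le> emeasure weighted_measure {t. 0 < t \<and> ennreal t < ennreal s}" if "0 < s" for s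
      unfolding W_eq using that by (intro k1) (auto simp: F_def ennreal_less_iff)
    have W_upper: "emeasure weighted_measure {t. 0 < t \<and> ennreal t < ennreal s} \<le> ennreal (k2 * B s)" if "0 < s" for s
      unfolding W_eq using that by (intro k2 F) (auto simp: F_def indicator_def ennreal_less_iff)
    have W_top: "emeasure weighted_measure {t. 0 < t \<and> ennreal t < \<infinity>} = \<infinity>"
      unfolding W_eq by (intro profile_infinite) (auto simp: F_def)
    have V_top: "V \<infinity> = \<infinity>"
    proof (rule ccontr)
      assume "V \<infinity> \<noteq> \<infinity>"
      then obtain y where y: "V \<infinity> = ennreal y" "0 \<le> y" by (cases "V \<infinity>") auto
      obtain m where m: "0 < m" "y / c < B m" using unbounded by blast
      have "c * B m \<le> y" using V_lower[of m \<infinity>] y c_pos m nonneg[of m] by simp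
      with m c_pos show False by (simp add: field_simps)
    qed
    show thesis
    proof (rule that[of "D / k1" "k2 * (2 * C) / c"]; (intro allI)?)
      show "0 < D / k1" "0 < k2 * (2 * C) / c"
        using D_pos k1 k2 c_pos C_pos by auto
      fix d
      consider "d = 0" | s where "d = ennreal s" "0 < s" | "d = \<infinity>"
        by (cases d) (auto simp: less_le)
      then have "V d \<le> ennreal (D / k1) * emeasure weighted_measure {t. 0 < t \<and> ennreal t < d} \<and>
        emeasure weighted_measure {t. 0 < t \<and> ennreal t < d} \<le> ennreal (k2 * (2 * C) / c) * V d"
      proof cases
        case 1
        then show ?thesis by (simp add: V_def)
      next
        case (2 s)
        have "V d \<le> ennreal (D / k1 * (k1 * B s))" using V_upper[OF 2(2)] 2 k1 by simp
        also have "\<dots> = ennreal (D / k1) * ennreal (k1 * B s)"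
          using D_pos k1 by (intro ennreal_mult') auto
        also have "\<dots> \<le> ennreal (D / k1) * emeasure weighted_measure {t. 0 < t \<and> ennreal t < d}"
          using W_lower[OF 2(2)] 2(1) by (intro mult_left_mono) auto
        finally have 1: "V d \<le> ennreal (D / k1) * emeasure weighted_measure {t. 0 < t \<and> ennreal t < d}" .
        \<comment> \<open>\<open>V_lower\<close> uses a closed interval strictly inside
          \<open>[0, s)\<close>, so it is applied at \<open>s / 2\<close>; linear growth pays for
          this with the factor \<open>2 * C\<close>.\<close>
        have "B s \<le> C * 2 * B (s / 2)" using le_linear[of "s / 2" s] 2 by simp
        then have "k2 * B s \<le> k2 * (C * 2 * B (s / 2))" using k2 by (intro mult_left_mono) auto
        also have "\<dots> = k2 * (2 * C) / c * (c * B (s / 2))" using c_pos by simp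
        finally have "emeasure weighted_measure {t. 0 < t \<and> ennreal t < d} \<le> ennreal (k2 * (2 * C) / c * (c * B (s / 2)))"
          using W_upper[OF 2(2)] 2(1) ennreal_leI order_trans by blast
        also have "\<dots> = ennreal (k2 * (2 * C) / c) * ennreal (c * B (s / 2))"
          using k2 C_pos c_pos by (intro ennreal_mult') auto
        also have "\<dots> \<le> ennreal (k2 * (2 * C) / c) * V d"
          using 2 by (intro mult_left_mono V_lower) (auto simp: ennreal_less_iff)
        finally show ?thesis using 1 by simp
      next
        case 3
        then show ?thesis using V_top W_top D_pos k1 k2 c_pos C_pos
          by (simp add: ennreal_mult_top)
      qed
      then show "emeasure (stieltjes \<psi>) {t. 0 \<le> t \<and> ennreal t < d} \<le> ennreal (D / k1) * emeasure weighted_measure {t. 0 < t \<and> ennreal t < d}"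
        "emeasure weighted_measure {t. 0 < t \<and> ennreal t < d} \<le> ennreal (k2 * (2 * C) / c) * emeasure (stieltjes \<psi>) {t. 0 \<le> t \<and> ennreal t < d}"
        by (auto simp: V_def)
    qed
  qed
qed

text \<open>At each level \<open>l\<close> the rearrangement exceeds \<open>l\<close> exactly on the
  initial interval cut off at \<open>d l\<close>, the distribution function of \<open>f\<close>.
  Both functionals therefore reduce to masses of the same intervals, up to the point 0, under the
  two measures.\<close>

lemma Lorentz_norm_equiv:
  "equiv_on (measurable_funs R) (Lorentz_norm R \<psi>)
    (\<lambda>f. Lq_norm 1 (\<lambda>t. ennreal (t powr (- recip 1)) * (ennreal (B t) * rearr R f t)))"
proof -
  obtain K L :: real where KL: "0 < K" "0 < L"
    "\<forall>d. emeasure (stieltjes \<psi>) {t. 0 \<le> t \<and> ennreal t < d} \<le> ennreal K * emeasure weighted_measure {t. 0 < t \<and> ennreal t < d}"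
    "\<forall>d. emeasure weighted_measure {t. 0 < t \<and> ennreal t < d} \<le> ennreal L * emeasure (stieltjes \<psi>) {t. 0 \<le> t \<and> ennreal t < d}"
    by (rule level_sets_comparable)
  have "equiv_on (measurable_funs R)
    (\<lambda>f. Lq_norm 1 (\<lambda>t. ennreal (t powr (- recip 1)) * (ennreal (B t) * rearr R f t))) (Lorentz_norm R \<psi>)"
  proof (rule equiv_onI[of "1 / L" _ _ _ K])
    fix f assume f: "f \<in> measurable_funs R"
    note [measurable] = borel_measurable_rearr[OF f]
    have r_leb: "rearr R f \<in> borel_measurable (lebesgue_on {0<..})"
      by (rule borel_measurable_lebesgue_on) measurable
    then have r_W: "rearr R f \<in> borel_measurable weighted_measure" by (simp add: weighted_measure_def)
    have r_S: "(\<lambda>t. rearr R f t * indicator {0..} t) \<in> borel_measurable (stieltjes \<psi>)"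
      by measurable
    define d where "d l = emeasure R {x \<in> space R. ennreal l < emod (f x)}" for l
    have lev1: "{t \<in> space (stieltjes \<psi>). ennreal l < rearr R f t * indicator {0..} t} =
        {t. 0 \<le> t \<and> ennreal t < d l}" if "0 < l" for l
      by (auto simp: less_rearr_iff[OF f] d_def indicator_def)
    have lev2: "{t \<in> space weighted_measure. ennreal l < rearr R f t} = {t. 0 < t \<and> ennreal t < d l}" for l
      by (auto simp: less_rearr_iff[OF f] d_def weighted_measure_def)
    have "(\<integral>\<^sup>+t. rearr R f t \<partial>weighted_measure) \<le> ennreal L * Lorentz_norm R \<psi> f"
      unfolding Lorentz_norm_def
      by (rule nn_integral_le_level_sets[OF sigma_finite_weighted sigma_finite_stieltjes r_W r_S])
        (simp only: lev1 lev2 KL)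
    then have "ennreal (1 / L) * (\<integral>\<^sup>+t. rearr R f t \<partial>weighted_measure) \<le> ennreal (1 / L) * (ennreal L * Lorentz_norm R \<psi> f)"
      by (rule mult_left_mono) simp
    also have "\<dots> = Lorentz_norm R \<psi> f"
    proof -
      have "ennreal (1 / L) * ennreal L = 1" using KL by (simp add: ennreal_mult'[symmetric])
      then show ?thesis by (simp only: mult.assoc[symmetric] mult_1_left)
    qed
    finally show "ennreal (1 / L) * Lq_norm 1 (\<lambda>t. ennreal (t powr (- recip 1)) * (ennreal (B t) * rearr R f t)) \<le> Lorentz_norm R \<psi> f"
      unfolding nn_integral_weighted[OF r_leb] .
    have "Lorentz_norm R \<psi> f \<le> ennreal K * (\<integral>\<^sup>+t. rearr R f t \<partial>weighted_measure)"
      unfolding Lorentz_norm_def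
      by (rule nn_integral_le_level_sets[OF sigma_finite_stieltjes sigma_finite_weighted r_S r_W])
        (simp only: lev1 lev2 KL)
    then show "Lorentz_norm R \<psi> f \<le> ennreal K * Lq_norm 1 (\<lambda>t. ennreal (t powr (- recip 1)) * (ennreal (B t) * rearr R f t))"
      unfolding nn_integral_weighted[OF r_leb] .
  qed (use KL in auto)
  then show ?thesis by (rule equiv_on_sym)
qed

text \<open>The supremum bounds the essential supremum pointwise. Conversely, its term at
  \<open>s\<close> is controlled by the values on \<open>(s, 2 * s)\<close>, an interval of positive
  length, through doubling of the average and almost monotonicity of \<open>B\<close>.\<close>

lemma Marcinkiewicz_norm_equiv:
  "equiv_on (measurable_funs R) (Marcinkiewicz_norm R \<psi>)
    (\<lambda>f. Lq_norm \<infinity> (\<lambda>t. ennreal (t powr (- recip \<infinity>)) * (ennreal (B t) * max_rearr R f t)))"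
    (is "equiv_on _ _ ?N")
proof (rule Lq_norm_lower[of \<infinity>])
  fix \<kappa> :: real assume \<kappa>: "0 < \<kappa>" "\<And>s y G. 0 < s \<Longrightarrow> 0 \<le> y \<Longrightarrow> (\<And>t. t \<in> {s/2<..<s} \<Longrightarrow> ennreal y \<le> G t) \<Longrightarrow>
      ennreal (\<kappa> * y) \<le> Lq_norm \<infinity> (\<lambda>t. ennreal (t powr (- recip \<infinity>)) * G t)"
  show ?thesis
  \<comment> \<open>The factor 2 is the doubling constant; \<open>C * D\<close> comes from bounding
    \<open>\<psi> s\<close> by \<open>D * B s\<close> and then \<open>B s\<close> by
    \<open>C * B t\<close>.\<close>
  proof (rule equiv_onI[of "\<kappa> / (2 * C * D)" _ _ _ "1 / c"])
    fix f assume f: "f \<in> measurable_funs R"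
    have lb: "ennreal (\<kappa> / (2 * C * D)) * (ennreal (\<psi> s) * max_rearr R f s) \<le> ?N f" if s: "0 < s" for s
    \<comment> \<open>The term at \<open>s\<close> may be infinite while \<open>\<kappa>(2)\<close>
      takes a real lower bound, so arbitrary finite values \<open>w\<close> strictly below it are
      used.\<close>
    proof (rule dense_le)
      fix w assume w: "w < ennreal (\<kappa> / (2 * C * D)) * (ennreal (\<psi> s) * max_rearr R f s)"
      have "w < \<infinity>" using w by (auto simp: less_top[symmetric])
      define y where "y = enn2real w / \<kappa>"
      have y: "0 \<le> y" "w = ennreal (\<kappa> * y)"
        using \<kappa> \<open>w < \<infinity>\<close> by (auto simp: y_def less_top)
      have "ennreal y \<le> ennreal (B t) * max_rearr R f t" if t: "t \<in> {(2 * s)/2<..<2 * s}" for t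
      proof -
        have e: "ennreal (x * z) = ennreal x * ennreal z" if "0 \<le> x" for x z
          using that by (rule ennreal_mult')
        have "ennreal (1 / \<kappa>) * w \<le> ennreal (1 / \<kappa>) * (ennreal (\<kappa> / (2 * C * D)) * (ennreal (\<psi> s) * max_rearr R f s))"
          using w by (intro mult_left_mono) auto
        also have "ennreal (1 / \<kappa>) * w = ennreal y"
          using \<kappa> y by (simp add: ennreal_mult'[symmetric])
        also have "ennreal (1 / \<kappa>) * (ennreal (\<kappa> / (2 * C * D)) * (ennreal (\<psi> s) * max_rearr R f s))
          = ennreal (1 / \<kappa> * (\<kappa> / (2 * C * D)) * \<psi> s) * max_rearr R f s"
        proof -
          have "0 \<le> 1 / \<kappa>" "0 \<le> \<kappa> / (2 * C * D)" using \<kappa> C_pos D_pos by auto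
          then show ?thesis by (simp only: e mult.assoc)
        qed
        also have "\<dots> \<le> ennreal (1 / \<kappa> * (\<kappa> / (2 * C * D)) * \<psi> s) * (2 * max_rearr R f t)"
          using t s by (intro mult_left_mono max_rearr_doubling) auto
        also have "\<dots> = ennreal (1 / \<kappa> * (\<kappa> / (2 * C * D)) * \<psi> s * 2) * max_rearr R f t"
          by (subst ennreal_mult''[of 2]) (simp_all add: mult_ac)
        also have "\<dots> \<le> ennreal (B t) * max_rearr R f t"
        proof (intro mult_right_mono ennreal_leI)
          have "\<psi> s \<le> D * B s" using s by (rule le)
          also have "\<dots> \<le> D * (C * B t)" using s t D_pos by (intro mult_left_mono almost_mono) auto
          finally show "1 / \<kappa> * (\<kappa> / (2 * C * D)) * \<psi> s * 2 \<le> B t"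
            using \<kappa> C_pos D_pos by (simp add: field_simps)
        qed simp
        finally show ?thesis .
      qed
      then show "w \<le> ?N f" unfolding y(2) using s y(1) by (intro \<kappa>(2)[of "2 * s"]) auto
    qed
    show "ennreal (\<kappa> / (2 * C * D)) * Marcinkiewicz_norm R \<psi> f \<le> ?N f"
      unfolding Marcinkiewicz_norm_def SUP_mult_left_ennreal by (intro SUP_least lb) simp
    have "(\<lambda>t. max_rearr R f t) \<in> borel_measurable (lebesgue_on {0<..})"
      by (intro borel_measurable_lebesgue_on borel_measurable_max_rearr borel_measurable_rearr f)
    then have meas: "(\<lambda>t. ennreal (B t) * max_rearr R f t) \<in> borel_measurable (lebesgue_on {0<..})"
      by measurable
    have "ennreal (B t) * max_rearr R f t \<le> ennreal (1 / c) * Marcinkiewicz_norm R \<psi> f" if t: "0 < t" for t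
    proof -
      have "ennreal (B t) * max_rearr R f t \<le> ennreal (1 / c * \<psi> t) * max_rearr R f t"
        using ge[OF t] c_pos by (intro mult_right_mono ennreal_leI) (auto simp: field_simps)
      also have "\<dots> = ennreal (1 / c) * (ennreal (\<psi> t) * max_rearr R f t)"
        using c_pos by (subst ennreal_mult') (simp_all only: mult.assoc divide_nonneg_pos zero_le_one)
      also have "\<dots> \<le> ennreal (1 / c) * Marcinkiewicz_norm R \<psi> f"
        unfolding Marcinkiewicz_norm_def using t by (intro mult_left_mono SUP_upper) auto
      finally show ?thesis .
    qed
    then have "esssup (lebesgue_on {0<..}) (\<lambda>t. ennreal (B t) * max_rearr R f t) \<le> ennreal (1 / c) * Marcinkiewicz_norm R \<psi> f"
      by (intro esssup_I[OF meas] AE_I2) simp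
    moreover have "?N f \<le> esssup (lebesgue_on {0<..}) (\<lambda>t. ennreal (B t) * max_rearr R f t)"
    proof -
      have "(\<lambda>t. ennreal (t powr (- recip \<infinity>)) * (ennreal (B t) * max_rearr R f t)) \<in> borel_measurable (lebesgue_on {0<..})"
        by (rule borel_measurable_times_ennreal[OF borel_measurable_lebesgue_on meas]) measurable
      then show ?thesis unfolding Lq_norm_def by (auto intro!: esssup_mono)
    qed
    ultimately show "?N f \<le> ennreal (1 / c) * Marcinkiewicz_norm R \<psi> f" by order
  qed (use \<kappa> C_pos D_pos in auto)
qed simp

end

section \<open>Fundamental functions\<close>

text \<open>Splitting the exponent separates the weight \<open>t^(1/p) b(t)\<close> from the factor
  \<open>t^(-1/q)\<close> that produces \<open>dt / t\<close>.\<close>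

lemma LK_norm_eq:
  "LK_norm R p q b f =
    Lq_norm q (\<lambda>t. ennreal (t powr (- recip q)) * (ennreal (t powr recip p * b t) * rearr R f t))"
proof -
  have "ennreal (t powr (recip p - recip q) * b t) = ennreal (t powr (- recip q)) * ennreal (t powr recip p * b t)" for t
  proof -
    have "t powr (recip p - recip q) = t powr (- recip q) * t powr recip p"
      unfolding powr_add[symmetric] by simp
    then show ?thesis by (simp only: ennreal_mult'[OF powr_ge_zero] mult.assoc)
  qed
  then show ?thesis by (simp only: LK_norm_def mult.assoc)
qed

lemma LK_max_norm_eq:
  "LK_max_norm R p q b f =
    Lq_norm q (\<lambda>t. ennreal (t powr (- recip q)) * (ennreal (t powr recip p * b t) * max_rearr R f t))"
proof -
  have "ennreal (t powr (recip p - recip q) * b t) = ennreal (t powr (- recip q)) * ennreal (t powr recip p * b t)" for t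
  proof -
    have "t powr (recip p - recip q) = t powr (- recip q) * t powr recip p"
      unfolding powr_add[symmetric] by simp
    then show ?thesis by (simp only: ennreal_mult'[OF powr_ge_zero] mult.assoc)
  qed
  then show ?thesis by (simp only: LK_max_norm_def mult.assoc)
qed

section \<open>From slow variation to power bounds\<close>

lemma slowly_varying_pos: "slowly_varying b \<Longrightarrow> 0 < t \<Longrightarrow> 0 < b t"
  by (simp add: slowly_varying_def)

lemma equiv_mono_almost:
  fixes u g :: "real \<Rightarrow> real"
  assumes "mono_on {0<..} g" "\<forall>t>0. 0 \<le> g t" "\<forall>t>0. 0 \<le> u t"
    and "equiv_on {0<..} (\<lambda>t. ennreal (u t)) (\<lambda>t. ennreal (g t))"
  obtains C where "0 < C" "\<forall>s t. 0 < s \<and> s \<le> t \<longrightarrow> u s \<le> C * u t"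
proof -
  obtain c D :: real where c: "0 < c" "0 < D" "\<forall>t\<in>{0<..}. c * u t \<le> g t" "\<forall>t\<in>{0<..}. g t \<le> D * u t"
    using assms(4) by (rule equiv_on_ennrealE) (use assms(2,3) in auto)
  have "u s \<le> D / c * u t" if "0 < s" "s \<le> t" for s t
  proof -
    have pos: "0 < s" "0 < t" using that by auto
    have "c * u s \<le> g s" using c(3) pos by simp
    also have "g s \<le> g t" using mono_onD[OF assms(1), of s t] pos that by simp
    also have "g t \<le> D * u t" using c(4) pos by simp
    finally show ?thesis using c(1) by (simp add: field_simps)
  qed
  then show thesis using c(1,2) by (intro that[of "D / c"]) auto
qed

lemma equiv_antimono_almost:
  fixes u g :: "real \<Rightarrow> real"
  assumes "antimono_on {0<..} g" "\<forall>t>0. 0 \<le> g t" "\<forall>t>0. 0 \<le> u t"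
    and "equiv_on {0<..} (\<lambda>t. ennreal (u t)) (\<lambda>t. ennreal (g t))"
  obtains C where "0 < C" "\<forall>s t. 0 < s \<and> s \<le> t \<longrightarrow> u t \<le> C * u s"
proof -
  obtain c D :: real where c: "0 < c" "0 < D" "\<forall>t\<in>{0<..}. c * u t \<le> g t" "\<forall>t\<in>{0<..}. g t \<le> D * u t"
    using assms(4) by (rule equiv_on_ennrealE) (use assms(2,3) in auto)
  have "u t \<le> D / c * u s" if "0 < s" "s \<le> t" for s t
  proof -
    have pos: "0 < s" "0 < t" using that by auto
    have "c * u t \<le> g t" using c(3) pos by simp
    also have "g t \<le> g s" using monotone_onD[OF assms(1), of s t] pos that by simp
    also have "g s \<le> D * u s" using c(4) pos by simp
    finally show ?thesis using c(1) by (simp add: field_simps)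
  qed
  then show thesis using c(1,2) by (intro that[of "D / c"]) auto
qed

lemma slowly_varying_almost_mono:
  assumes b: "slowly_varying b" and e: "0 < e"
  obtains C where "0 < C" "\<forall>s t. 0 < s \<and> s \<le> t \<longrightarrow> s powr e * b s \<le> C * (t powr e * b t)"
proof -
  have "\<exists>g :: real \<Rightarrow> real. mono_on {0<..} g \<and> (\<forall>t>0. 0 \<le> g t) \<and>
    equiv_on {0<..} (\<lambda>t. ennreal (t powr e * b t)) (\<lambda>t. ennreal (g t))"
    using b e by (simp add: slowly_varying_def)
  then obtain g :: "real \<Rightarrow> real" where g: "mono_on {0<..} g" "\<forall>t>0. 0 \<le> g t"
    "equiv_on {0<..} (\<lambda>t. ennreal (t powr e * b t)) (\<lambda>t. ennreal (g t))"
    by (elim exE conjE)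
  have nonneg: "\<forall>t>0. 0 \<le> t powr e * b t"
    using slowly_varying_pos[OF b] by (simp add: less_imp_le)
  show thesis
    using that by (rule equiv_mono_almost[OF g(1,2) nonneg g(3)])
qed

lemma slowly_varying_almost_antimono:
  assumes b: "slowly_varying b" and e: "0 < e"
  obtains C where "0 < C" "\<forall>s t. 0 < s \<and> s \<le> t \<longrightarrow> t powr (- e) * b t \<le> C * (s powr (- e) * b s)"
proof -
  have "\<exists>g :: real \<Rightarrow> real. antimono_on {0<..} g \<and> (\<forall>t>0. 0 \<le> g t) \<and>
    equiv_on {0<..} (\<lambda>t. ennreal (t powr (- e) * b t)) (\<lambda>t. ennreal (g t))"
    using b e by (simp add: slowly_varying_def)
  then obtain g :: "real \<Rightarrow> real" where g: "antimono_on {0<..} g" "\<forall>t>0. 0 \<le> g t"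
    "equiv_on {0<..} (\<lambda>t. ennreal (t powr (- e) * b t)) (\<lambda>t. ennreal (g t))"
    by (elim exE conjE)
  have nonneg: "\<forall>t>0. 0 \<le> t powr (- e) * b t"
    using slowly_varying_pos[OF b] by (simp add: less_imp_le)
  show thesis
    using that by (rule equiv_antimono_almost[OF g(1,2) nonneg g(3)])
qed

text \<open>Half of the power \<open>P\<close> is spent on making \<open>b\<close> almost
  increasing; the other half survives as the gain \<open>(s/t)^(P/2)\<close>. The upper exponent
  \<open>P + e\<close> comes from the almost decrease of \<open>t^(-e) b(t)\<close>, where
  \<open>e = 0\<close> is allowed in order to cover \<open>p = 1\<close>.\<close>

lemma power_weight_of_slowly_varying:
  assumes b: "slowly_varying b" and P: "0 < P" and Pe: "P + e \<le> 1" and K: "0 < K"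
    and dec: "\<forall>s t. 0 < s \<and> s \<le> t \<longrightarrow> t powr (- e) * b t \<le> K * (s powr (- e) * b s)"
  obtains C where "power_weight (\<lambda>t. t powr P * b t) (P / 2) (P + e) C"
proof -
  obtain L where L: "0 < L"
    "\<forall>s t. 0 < s \<and> s \<le> t \<longrightarrow> s powr (P / 2) * b s \<le> L * (t powr (P / 2) * b t)"
    by (rule slowly_varying_almost_mono[OF b, of "P / 2"]) (use P in auto)
  show thesis
  proof (rule that[of "max L K"], unfold_locales)
    have [measurable]: "b \<in> borel_measurable (lebesgue_on {0<..})"
      using b by (simp add: slowly_varying_def)
    have [measurable]: "(\<lambda>t. t powr P) \<in> borel_measurable (lebesgue_on {0<..})"
      by (rule borel_measurable_lebesgue_on) measurable
    show "(\<lambda>t. t powr P * b t) \<in> borel_measurable (lebesgue_on {0<..})" by measurable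
    show "0 < t powr P * b t" if "0 < t" for t using that slowly_varying_pos[OF b that] by simp
    show "0 < P / 2" "P + e \<le> 1" "0 < max L K" using P Pe K by auto
    fix s t :: real assume st: "0 < s" "s \<le> t"
    have bs: "0 < b s" "0 < b t" using slowly_varying_pos[OF b] st by auto
    have "s powr P * b s = s powr (P / 2) * (s powr (P / 2) * b s)"
      by (simp add: mult.assoc[symmetric] powr_add[symmetric])
    also have "\<dots> \<le> s powr (P / 2) * (L * (t powr (P / 2) * b t))"
      using L st by (intro mult_left_mono) auto
    also have "\<dots> = L * ((s / t) powr (P / 2) * (t powr P * b t))"
    proof -
      have "t powr P = t powr (P / 2) * t powr (P / 2)" by (simp add: powr_add[symmetric])
      then show ?thesis using st by (simp add: powr_divide)
    qed
    also have "\<dots> \<le> max L K * ((s / t) powr (P / 2) * (t powr P * b t))"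
      using bs by (intro mult_right_mono) auto
    finally show "s powr P * b s \<le> max L K * (s / t) powr (P / 2) * (t powr P * b t)"
      by (simp add: mult.assoc)
    have "t powr P * b t = t powr (P + e) * (t powr (- e) * b t)"
      by (simp add: mult.assoc[symmetric] powr_add[symmetric])
    also have "\<dots> \<le> t powr (P + e) * (K * (s powr (- e) * b s))"
      using dec st by (intro mult_left_mono) auto
    also have "\<dots> = K * ((t / s) powr (P + e) * (s powr P * b s))"
    proof -
      have "s powr P * s powr (-e) / s powr P = s powr (- e)" using st by simp
      then show ?thesis using st by (simp add: powr_divide powr_add powr_minus field_simps)
    qed
    also have "\<dots> \<le> max L K * ((t / s) powr (P + e) * (s powr P * b s))"
      using bs by (intro mult_right_mono) auto
    finally show "t powr P * b t \<le> max L K * (t / s) powr (P + e) * (s powr P * b s)"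
      by (simp add: mult.assoc)
  qed
qed

lemma recip_bounds:
  assumes "1 \<le> p" "p < \<infinity>"
  shows "0 < recip p" "recip p \<le> 1" "1 < p \<Longrightarrow> recip p < 1"
proof -
  obtain x where x: "p = ennreal x" "1 \<le> x"
    using assms by (cases p) (auto simp flip: ennreal_1)
  then have "recip p = 1 / x" by (simp add: recip_def divide_ennreal flip: ennreal_1)
  moreover have "1 < x" if "1 < p" using that x ennreal_less_iff[of 1 x] by simp
  ultimately show "0 < recip p" "recip p \<le> 1" "1 < p \<Longrightarrow> recip p < 1"
    using x by auto
qed

lemma equiv_on_subset:
  assumes "equiv_on S g h" "T \<subseteq> S"
  shows "equiv_on T g h"
proof -
  obtain c C :: real where c: "0 < c" "0 < C" "\<forall>x\<in>S. ennreal c * g x \<le> h x" "\<forall>x\<in>S. h x \<le> ennreal C * g x"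
    using assms(1) by (rule equiv_onE)
  then show ?thesis using assms(2) by (intro equiv_onI[OF c(1), of _ _ _ C]) auto
qed

text \<open>The definite description is meaningful because the rearrangement of a characteristic
  function depends only on the measure of the set.\<close>

lemma fundamental_function_eq:
  assumes N: "\<And>f g. rearr R f = rearr R g \<Longrightarrow> N f = N g" and E: "E \<in> sets R"
  shows "fundamental_function R N (emeasure R E) = N (char_fun E)"
  unfolding fundamental_function_def
proof (rule the_equality)
  show "\<forall>F\<in>sets R. emeasure R F = emeasure R E \<longrightarrow> N (char_fun F) = N (char_fun E)"
    by (auto intro!: N simp: rearr_char_fun E)
qed (use E in auto)

section \<open>Fundamental function and endpoint spaces of a power weight\<close>

context power_weight
begin

lemma fundamental_function_bounds:
  assumes ex: "\<And>t. \<exists>E\<in>sets R. emeasure R E = t" and q: "0 < q"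
    and F_cong: "\<And>f g. rearr R f = rearr R g \<Longrightarrow> F f = F g"
    and F_meas: "\<And>E. E \<in> sets R \<Longrightarrow> F (char_fun E) \<in> borel_measurable (lebesgue_on {0<..})"
    and F_le: "\<And>E t. E \<in> sets R \<Longrightarrow> F (char_fun E) t \<le> 1"
    and F_eq: "\<And>E t. E \<in> sets R \<Longrightarrow> 0 < t \<Longrightarrow> ennreal t < emeasure R E \<Longrightarrow> F (char_fun E) t = 1"
    and F_tail: "\<And>E m t. E \<in> sets R \<Longrightarrow> emeasure R E = ennreal m \<Longrightarrow> 0 \<le> m \<Longrightarrow> 0 < t \<Longrightarrow> m \<le> t \<Longrightarrow>
      F (char_fun E) t = 0 \<or> A < 1 \<and> F (char_fun E) t \<le> ennreal (m / t)"
    and N: "\<And>f. N f = Lq_norm q (\<lambda>t. ennreal (t powr (- recip q)) * (ennreal (B t) * F f t))"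
  shows "equiv_on {0<..} (\<lambda>t. fundamental_function R N (ennreal t)) (\<lambda>t. ennreal (B t))"
    and "fundamental_function R N \<infinity> = \<infinity>"
proof -
  have N_cong: "N f = N g" if "rearr R f = rearr R g" for f g
    using F_cong[OF that] by (simp add: N)
  have fund: "\<exists>E\<in>sets R. emeasure R E = t \<and> fundamental_function R N t = N (char_fun E)" for t
    using ex[of t] fundamental_function_eq[of R N, OF N_cong] by fastforce
  show "fundamental_function R N \<infinity> = \<infinity>"
  proof -
    obtain E where "E \<in> sets R" "emeasure R E = \<infinity>" "fundamental_function R N \<infinity> = N (char_fun E)"
      using fund by blast
    then show ?thesis using F_eq by (simp add: N profile_infinite[OF q] less_top[symmetric])
  qed
  have "equiv_on {0<..} (\<lambda>t. ennreal (B t)) (\<lambda>t. fundamental_function R N (ennreal t))"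
  proof (rule profile_lower[OF q])
    fix k1 assume k1: "0 < k1" "\<And>m F. 0 < m \<Longrightarrow> (\<And>t. 0 < t \<Longrightarrow> t < m \<Longrightarrow> F t = 1) \<Longrightarrow>
        ennreal (k1 * B m) \<le> Lq_norm q (\<lambda>t. ennreal (t powr (- recip q)) * (ennreal (B t) * F t))"
    show ?thesis
    proof (rule profile_upper[OF q])
      fix k2 assume k2: "0 < k2" "\<And>m F. 0 < m \<Longrightarrow> F \<in> borel_measurable (lebesgue_on {0<..}) \<Longrightarrow> (\<And>t. F t \<le> 1) \<Longrightarrow>
        (\<And>t. m \<le> t \<Longrightarrow> F t = 0 \<or> A < 1 \<and> F t \<le> ennreal (m / t)) \<Longrightarrow>
        Lq_norm q (\<lambda>t. ennreal (t powr (- recip q)) * (ennreal (B t) * F t)) \<le> ennreal (k2 * B m)"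
      show ?thesis
      proof (rule equiv_onI[OF k1(1), where C = k2])
        fix t :: real assume "t \<in> {0<..}"
        then have t: "0 < t" by simp
        obtain E where E: "E \<in> sets R" "emeasure R E = ennreal t"
          "fundamental_function R N (ennreal t) = N (char_fun E)"
          using fund by blast
        have "ennreal (k1 * B t) \<le> fundamental_function R N (ennreal t)"
          unfolding E(3) N using t E by (intro k1 F_eq) (auto simp: ennreal_less_iff)
        then show "ennreal k1 * ennreal (B t) \<le> fundamental_function R N (ennreal t)"
          using k1(1) by (simp add: ennreal_mult')
        have "fundamental_function R N (ennreal t) \<le> ennreal (k2 * B t)"
          unfolding E(3) N using t by (intro k2 F_tail[OF E(1,2)] F_le[OF E(1)] F_meas[OF E(1)]) auto
        then show "fundamental_function R N (ennreal t) \<le> ennreal k2 * ennreal (B t)"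
          using k2(1) by (simp add: ennreal_mult')
      qed
    qed
  qed
  then show "equiv_on {0<..} (\<lambda>t. fundamental_function R N (ennreal t)) (\<lambda>t. ennreal (B t))"
    by (rule equiv_on_sym)
qed

lemma
  assumes ex: "\<And>t. \<exists>E\<in>sets R. emeasure R E = t" and q: "0 < q"
  shows fundamental_function_rearr:
    "N = (\<lambda>f. Lq_norm q (\<lambda>t. ennreal (t powr (- recip q)) * (ennreal (B t) * rearr R f t))) \<Longrightarrow>
      equiv_on {0<..} (\<lambda>t. fundamental_function R N (ennreal t)) (\<lambda>t. ennreal (B t)) \<and>
      fundamental_function R N \<infinity> = \<infinity>"
    and fundamental_function_max_rearr:
    "A < 1 \<Longrightarrow> N = (\<lambda>f. Lq_norm q (\<lambda>t. ennreal (t powr (- recip q)) * (ennreal (B t) * max_rearr R f t))) \<Longrightarrow>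
      equiv_on {0<..} (\<lambda>t. fundamental_function R N (ennreal t)) (\<lambda>t. ennreal (B t)) \<and>
      fundamental_function R N \<infinity> = \<infinity>"
proof -
  have meas: "rearr R (char_fun E) \<in> borel_measurable borel" if "E \<in> sets R" for E
    by (rule measurable_cong[THEN iffD2, OF rearr_char_fun[OF that]]) measurable
  have le1: "rearr R (char_fun E) t \<le> 1" if "E \<in> sets R" for E t
    by (simp add: rearr_char_fun[OF that])
  have max_le1: "max_rearr R (char_fun E) t \<le> 1" if "E \<in> sets R" for E t
  proof (cases "0 < t")
    case True
    have "(\<integral>\<^sup>+ s\<in>{0<..<t}. rearr R (char_fun E) s \<partial>lborel) \<le> (\<integral>\<^sup>+ s. indicator {0<..<t} s \<partial>lborel)"
      by (intro nn_integral_mono) (auto simp: indicator_def le1[OF that])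
    also have "\<dots> = ennreal t" using True by simp
    finally have "max_rearr R (char_fun E) t \<le> ennreal t / ennreal t"
      unfolding max_rearr_def by (rule divide_right_mono_ennreal)
    then show ?thesis using True by (simp add: ennreal_divide_self)
  next
    \<comment> \<open>For such \<open>t\<close> the interval of integration is empty and
      \<open>ennreal t\<close> is 0; the quotient \<open>0 / 0\<close> equals 0 in
      \<open>ennreal\<close>.\<close>
    case False
    then show ?thesis by (simp add: max_rearr_def)
  qed
  show "equiv_on {0<..} (\<lambda>t. fundamental_function R N (ennreal t)) (\<lambda>t. ennreal (B t)) \<and>
      fundamental_function R N \<infinity> = \<infinity>"
    if "N = (\<lambda>f. Lq_norm q (\<lambda>t. ennreal (t powr (- recip q)) * (ennreal (B t) * rearr R f t)))"
    by (intro conjI; rule fundamental_function_bounds[OF ex q, where F = "rearr R"])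
      (auto simp: that le1 rearr_char_fun ennreal_less_iff intro: borel_measurable_lebesgue_on meas)
  show "equiv_on {0<..} (\<lambda>t. fundamental_function R N (ennreal t)) (\<lambda>t. ennreal (B t)) \<and>
      fundamental_function R N \<infinity> = \<infinity>" if "A < 1"
    "N = (\<lambda>f. Lq_norm q (\<lambda>t. ennreal (t powr (- recip q)) * (ennreal (B t) * max_rearr R f t)))"
    by (intro conjI; rule fundamental_function_bounds[OF ex q, where F = "max_rearr R"])
      (auto simp: that max_le1 max_rearr_char_fun_eq max_rearr_char_fun_le
        intro: borel_measurable_lebesgue_on borel_measurable_max_rearr meas max_rearr_cong)
qed

text \<open>For positive arguments the comparison goes through \<open>B\<close>. The definition of a
  representative also includes the point 0, where both sides vanish.\<close>

lemma equiv_on_envelope: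
  assumes eq: "equiv_on {0<..} (\<lambda>t. \<phi> (ennreal t)) (\<lambda>t. ennreal (B t))" and zero: "\<phi> 0 = 0"
  shows "equiv_on {0..} (\<lambda>t. \<phi> (ennreal t)) (\<lambda>t. ennreal (envelope t))"
proof -
  have "equiv_on {0<..} (\<lambda>t. ennreal (B t)) (\<lambda>t. ennreal (envelope t))"
  proof (rule equiv_onI[of "1 / C" _ _ _ 2])
    fix t :: real assume "t \<in> {0<..}"
    then have t: "0 < t" by simp
    have "ennreal (1 / C) * ennreal (B t) = ennreal (B t / C)"
      using C_pos by (simp add: ennreal_mult'[symmetric])
    also have "\<dots> \<le> ennreal (envelope t)" by (intro ennreal_leI envelope_lower t)
    finally show "ennreal (1 / C) * ennreal (B t) \<le> ennreal (envelope t)" .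
    have "ennreal (envelope t) \<le> ennreal (2 * B t)" by (intro ennreal_leI envelope_upper t)
    also have "\<dots> = ennreal 2 * ennreal (B t)" by (rule ennreal_mult') simp
    finally show "ennreal (envelope t) \<le> ennreal 2 * ennreal (B t)" .
  qed (use C_pos in auto)
  from equiv_on_trans[OF eq this] obtain k K :: real where k: "0 < k" "0 < K"
    "\<forall>t\<in>{0<..}. ennreal k * \<phi> (ennreal t) \<le> ennreal (envelope t)"
    "\<forall>t\<in>{0<..}. ennreal (envelope t) \<le> ennreal K * \<phi> (ennreal t)"
    by (rule equiv_onE)
  show ?thesis
  proof (rule equiv_onI[OF k(1), of _ _ _ K])
    fix t :: real assume "t \<in> {0..}"
    then consider "t = 0" | "t \<in> {0<..}" by fastforce
    then show "ennreal k * \<phi> (ennreal t) \<le> ennreal (envelope t)" "ennreal (envelope t) \<le> ennreal K * \<phi> (ennreal t)"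
      using k zero envelope_0 by (cases; simp)+
  qed
qed

text \<open>The envelope witnesses quasi-concavity and the existence of a representative. The
  identification of the spaces is proved for every representative, since each one satisfies the
  assumptions of \<open>concave_weight\<close> with the constants of its equivalence to
  \<open>B\<close>.\<close>

lemma endpoint_spaces:
  assumes eq: "equiv_on {0<..} (\<lambda>t. \<phi> (ennreal t)) (\<lambda>t. ennreal (B t))" and zero: "\<phi> 0 = 0"
  shows "equiv_quasi_concave \<phi>" "\<exists>\<psi>. concave_representative \<phi> \<psi>"
    and "concave_representative \<phi> \<psi> \<Longrightarrow>
      same_space R (Lorentz_norm R \<psi>)
        (\<lambda>f. Lq_norm 1 (\<lambda>t. ennreal (t powr (- recip 1)) * (ennreal (B t) * rearr R f t)))"
    and "concave_representative \<phi> \<psi> \<Longrightarrow>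
      same_space R (Marcinkiewicz_norm R \<psi>)
        (\<lambda>f. Lq_norm \<infinity> (\<lambda>t. ennreal (t powr (- recip \<infinity>)) * (ennreal (B t) * max_rearr R f t)))"
proof -
  note envelope_equiv = equiv_on_envelope[OF eq zero]
  show "equiv_quasi_concave \<phi>"
    unfolding equiv_quasi_concave_def by (intro exI[of _ envelope] conjI quasi_concave_envelope envelope_equiv)
  show "\<exists>\<psi>. concave_representative \<phi> \<psi>"
    unfolding concave_representative_def
    by (intro exI[of _ envelope] conjI mono_envelope concave_envelope envelope_0 envelope_equiv)
  have cw: "\<exists>c D. concave_weight B a A C \<psi> c D" if rep: "concave_representative \<phi> \<psi>"
  proof -
    have mono: "mono_on {0..} \<psi>" and conc: "concave_on {0..} \<psi>" and z: "\<psi> 0 = 0"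
      and "equiv_on {0..} (\<lambda>t. \<phi> (ennreal t)) (\<lambda>t. ennreal (\<psi> t))"
      using rep by (simp_all add: concave_representative_def)
    then have "equiv_on {0<..} (\<lambda>t. \<phi> (ennreal t)) (\<lambda>t. ennreal (\<psi> t))"
      by (elim equiv_on_subset) auto
    then have "equiv_on {0<..} (\<lambda>t. ennreal (B t)) (\<lambda>t. ennreal (\<psi> t))"
      by (rule equiv_on_trans[OF equiv_on_sym[OF eq]])
    then obtain c D where c: "0 < c" "0 < D" "\<forall>t\<in>{0<..}. c * B t \<le> \<psi> t" "\<forall>t\<in>{0<..}. \<psi> t \<le> D * B t"
    proof (rule equiv_on_ennrealE)
      fix t :: real assume "t \<in> {0<..}"
      then show "0 \<le> B t" "0 \<le> \<psi> t" using nonneg[of t] mono_onD[OF mono, of 0 t] z by simp_all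
    qed (rule that)
    have "concave_weight B a A C \<psi> c D"
      by (unfold_locales) (use mono conc z c in simp_all)
    then show ?thesis by (intro exI)
  qed
  show "same_space R (Lorentz_norm R \<psi>)
      (\<lambda>f. Lq_norm 1 (\<lambda>t. ennreal (t powr (- recip 1)) * (ennreal (B t) * rearr R f t)))"
    if "concave_representative \<phi> \<psi>"
    using cw[OF that] by (elim exE) (rule same_spaceI, rule concave_weight.Lorentz_norm_equiv)
  show "same_space R (Marcinkiewicz_norm R \<psi>)
      (\<lambda>f. Lq_norm \<infinity> (\<lambda>t. ennreal (t powr (- recip \<infinity>)) * (ennreal (B t) * max_rearr R f t)))"
    if "concave_representative \<phi> \<psi>"
    using cw[OF that] by (elim exE) (rule same_spaceI, rule concave_weight.Marcinkiewicz_norm_equiv)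
qed

end

section \<open>Value at zero and the final assembly\<close>

lemma fundamental_function_0:
  assumes "\<And>f g. rearr R f = rearr R g \<Longrightarrow> N f = N g" "N (char_fun {}) = 0"
  shows "fundamental_function R N 0 = 0"
  using fundamental_function_eq[of R N "{}", OF assms(1)] assms(2) by simp

lemma Lq_norm_0: "0 < q \<Longrightarrow> Lq_norm q (\<lambda>t. 0) = 0"
proof (cases "q = \<infinity>")
  case True
  have "esssup (lebesgue_on {0<..}) (\<lambda>t::real. 0::ennreal) \<le> 0"
    by (rule esssup_I) auto
  then show ?thesis using True by (simp add: Lq_norm_def)
next
  case False
  have "epowr 0 a = 0" for a by (simp add: epowr_def)
  then show ?thesis using False by (simp add: Lq_norm_def)
qed

theorem theorem3p12:
  fixes R :: "'a measure" and p q :: ennreal and b :: "real \<Rightarrow> real"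
  assumes "sigma_finite_measure R" and "nonatomic R" and "emeasure R (space R) = \<infinity>"
    and "0 < p" and "0 < q" and "slowly_varying b"
    and "(1 < p \<and> p < \<infinity>) \<or> (p = 1 \<and> equiv_nonincreasing b)"
  shows "\<forall>N. N = LK_norm R p q b \<or> (1 < p \<and> N = LK_max_norm R p q b) \<longrightarrow>
    (let \<phi> = fundamental_function R N in
       equiv_on {0<..} (\<lambda>t. \<phi> (ennreal t)) (\<lambda>t. ennreal (t powr recip p * b t)) \<and>
       \<phi> \<infinity> = \<infinity> \<and>
       equiv_quasi_concave \<phi> \<and>
       (\<exists>\<psi>. concave_representative \<phi> \<psi>) \<and>
       (\<forall>\<psi>. concave_representative \<phi> \<psi> \<longrightarrow>
          same_space R (Lorentz_norm R \<psi>) (LK_norm R p 1 b) \<and>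
          same_space R (Marcinkiewicz_norm R \<psi>) (LK_max_norm R p \<infinity> b)))"
proof (intro allI impI)
  fix N assume N: "N = LK_norm R p q b \<or> (1 < p \<and> N = LK_max_norm R p q b)"
  define B where "B t = t powr recip p * b t" for t
  have p: "1 \<le> p" "p < \<infinity>" using assms(7) by auto
  have "\<exists>A C. power_weight B (recip p / 2) A C \<and> (1 < p \<longrightarrow> A < 1)"
  proof (cases "1 < p")
    case True
    \<comment> \<open>Half of the gap between \<open>1/p\<close> and 1, which keeps the upper
      exponent strictly below 1.\<close>
    define e where "e = (1 - recip p) / 2"
    have e: "0 < e" "recip p + e < 1" using recip_bounds(3)[OF p True] by (auto simp: e_def field_simps)
    obtain K where "0 < K" "\<forall>s t. 0 < s \<and> s \<le> t \<longrightarrow> t powr (- e) * b t \<le> K * (s powr (- e) * b s)"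
      using assms(6) e(1) by (rule slowly_varying_almost_antimono)
    then obtain C where "power_weight (\<lambda>t. t powr recip p * b t) (recip p / 2) (recip p + e) C"
      by (rule power_weight_of_slowly_varying[OF assms(6) recip_bounds(1)[OF p] less_imp_le[OF e(2)]])
    then show ?thesis using e(2) unfolding B_def[abs_def] by (intro exI conjI impI)
  next
    case False
    \<comment> \<open>For \<open>p = 1\<close> no room is left below the exponent 1, so the almost
      decrease of \<open>b\<close> itself is used with \<open>e = 0\<close>, giving
      \<open>A = 1\<close>.\<close>
    then have "equiv_nonincreasing b" using assms(7) by auto
    then obtain g :: "real \<Rightarrow> real" where g: "antimono_on {0<..} g" "\<forall>t>0. 0 \<le> g t"
      "equiv_on {0<..} (\<lambda>t. ennreal (b t)) (\<lambda>t. ennreal (g t))"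
      unfolding equiv_nonincreasing_def by (elim exE conjE)
    have "\<forall>t>0. 0 \<le> b t" using slowly_varying_pos[OF assms(6)] by (simp add: less_imp_le)
    from equiv_antimono_almost[OF g(1,2) this g(3)]
    obtain K where "0 < K" "\<forall>s t. 0 < s \<and> s \<le> t \<longrightarrow> b t \<le> K * b s" .
    then have dec: "\<forall>s t. 0 < s \<and> s \<le> t \<longrightarrow> t powr (- 0) * b t \<le> K * (s powr (- 0) * b s)"
      by simp
    have "recip p + 0 \<le> 1" using recip_bounds(2)[OF p] by simp
    from power_weight_of_slowly_varying[OF assms(6) recip_bounds(1)[OF p] this \<open>0 < K\<close> dec]
    obtain C where "power_weight (\<lambda>t. t powr recip p * b t) (recip p / 2) (recip p + 0) C" .
    then show ?thesis using False unfolding B_def[abs_def] by (intro exI conjI impI) simp_all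
  qed
  then obtain A C where weight: "power_weight B (recip p / 2) A C" and A: "1 < p \<longrightarrow> A < 1"
    by (elim exE conjE)
  interpret power_weight B "recip p / 2" A C by (rule weight)
  note ex = nonatomic_set_of_measure[OF assms(1-3)]
  \<comment> \<open>The exponent \<open>q\<close> is universally quantified here, since the
    rewriting serves the given \<open>q\<close> as well as the exponents 1 and infinity of the
    endpoint spaces.\<close>
  have LK: "LK_norm R p q b = (\<lambda>f. Lq_norm q (\<lambda>t. ennreal (t powr (- recip q)) * (ennreal (B t) * rearr R f t)))"
    "LK_max_norm R p q b = (\<lambda>f. Lq_norm q (\<lambda>t. ennreal (t powr (- recip q)) * (ennreal (B t) * max_rearr R f t)))" for q
    by (simp_all add: fun_eq_iff LK_norm_eq LK_max_norm_eq B_def)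
  define \<phi> where "\<phi> = fundamental_function R N"
  have *: "equiv_on {0<..} (\<lambda>t. \<phi> (ennreal t)) (\<lambda>t. ennreal (B t)) \<and> \<phi> \<infinity> = \<infinity>"
    using N
  proof (elim disjE conjE)
    assume "N = LK_norm R p q b"
    then show ?thesis unfolding \<phi>_def LK by (rule fundamental_function_rearr[OF ex assms(5)])
  next
    assume "1 < p" and "N = LK_max_norm R p q b"
    then show ?thesis
      unfolding \<phi>_def LK using A by (intro fundamental_function_max_rearr[OF ex assms(5)]) simp_all
  qed
  have zero: "\<phi> 0 = 0"
    unfolding \<phi>_def
  proof (rule fundamental_function_0)
    show "N f = N g" if "rearr R f = rearr R g" for f g
      using N max_rearr_cong[OF that] that by (auto simp: LK)
    have "rearr R (char_fun {}) = (\<lambda>t. 0)" by (simp add: fun_eq_iff rearr_char_fun)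
    then show "N (char_fun {}) = 0"
      using N Lq_norm_0[OF assms(5)] by (auto simp: LK max_rearr_def)
  qed
  note endpoint = endpoint_spaces[OF conjunct1[OF *] zero]
  show "let \<phi> = fundamental_function R N in
       equiv_on {0<..} (\<lambda>t. \<phi> (ennreal t)) (\<lambda>t. ennreal (t powr recip p * b t)) \<and>
       \<phi> \<infinity> = \<infinity> \<and> equiv_quasi_concave \<phi> \<and> (\<exists>\<psi>. concave_representative \<phi> \<psi>) \<and>
       (\<forall>\<psi>. concave_representative \<phi> \<psi> \<longrightarrow>
          same_space R (Lorentz_norm R \<psi>) (LK_norm R p 1 b) \<and>
          same_space R (Marcinkiewicz_norm R \<psi>) (LK_max_norm R p \<infinity> b))"
    unfolding Let_def \<phi>_def[symmetric] B_def[symmetric] LK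
    by (intro conjI allI impI endpoint conjunct1[OF *] conjunct2[OF *])
qed

end
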